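(* For every $h\in(1,2)$ there exist a uniformly continuous, compactly supported, weakly divergence-free velocity field $u\in C_c([0,\infty)\times\mathbb{R}^2;\mathbb{R}^2)$ and a time-dependent locally finite Borel measure $\omega=\omega(t)$ on $\mathbb{R}^2$ such that $\omega$ is weakly advected by $u$ on $[0,T]$ for every $T>0$, $\mathrm{supp}\,\omega(0)=\{(0,0)\}$, and $\dim_H\mathrm{supp}\,\omega(t)=h$ for all $t>0$. Moreover, $u$ is locally Lipschitz on $\big([0,\infty)\times\mathbb{R}^2\big)\setminus\{(0,(0,0))\}$.
   Context: Weak advection (2D): Let $T>0$ and $u\in C([0,T]\times\mathbb{R}^2;\mathbb{R}^2)$ be continuous and weakly divergence free. A family $\mu(t)$, $t\in[0,T]$, of locally finite Borel measures on $\mathbb{R}^2$ is weakly advected by $u$ on $[0,T]$ if for every $\phi\in C_c^\infty([0,T]\times\mathbb{R}^2)$ $$\int_0^T\!\!\int\partial_t\phi(t,x)\,d\mu(t)(x)\,dt-\int\phi(T,x)\,d\mu(T)(x)+\int\phi(0,x)\,d\mu(0)(x)+\int_0^T\!\!\int (u\cdot\nabla)\phi(t,x)\,d\mu(t)(x)\,dt=0.$$ $\dim_H$ denotes Hausdorff dimension. *)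

theory Defs
  imports "HOL-Analysis.Analysis"
begin

fun Ck :: "nat \<Rightarrow> ('a::euclidean_space \<Rightarrow> real) \<Rightarrow> bool" where
  "Ck 0 f = continuous_on UNIV f"
| "Ck (Suc k) f = ((\<forall>x. f differentiable (at x)) \<and>
      (\<forall>b\<in>Basis. Ck k (\<lambda>x. frechet_derivative f (at x) b)))"

definition smooth_fun :: "('a::euclidean_space \<Rightarrow> real) \<Rightarrow> bool" where
  "smooth_fun f \<longleftrightarrow> (\<forall>k. Ck k f)"

definition fun_support :: "('a::euclidean_space \<Rightarrow> real) \<Rightarrow> 'a set" where
  "fun_support f = closure {x. f x \<noteq> 0}"

definition test_fun :: "('a::euclidean_space \<Rightarrow> real) \<Rightarrow> bool" where
  "test_fun f \<longleftrightarrow> smooth_fun f \<and> compact (fun_support f)"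

definition weakly_div_free :: "(real \<Rightarrow> real^2 \<Rightarrow> real^2) \<Rightarrow> bool" where
  "weakly_div_free u \<longleftrightarrow> (\<forall>t\<ge>0. \<forall>\<psi>::real^2 \<Rightarrow> real. test_fun \<psi> \<longrightarrow>
      integrable lborel (\<lambda>x. frechet_derivative \<psi> (at x) (u t x)) \<and>
      (\<integral>x. frechet_derivative \<psi> (at x) (u t x) \<partial>lborel) = 0)"

text \<open>Weak advection of a family of measures mu(t) by u on [0,T]. Test functions are
  restrictions of C_c^infinity functions on R x R^2; the time derivative is the derivative
  in direction (1,0) and (u . grad) phi is the derivative in direction (0, u(t,x)).\<close>
definition weakly_advected ::
  "(real \<Rightarrow> real^2 \<Rightarrow> real^2) \<Rightarrow> (real \<Rightarrow> (real^2) measure) \<Rightarrow> real \<Rightarrow> bool" where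
  "weakly_advected u \<mu> T \<longleftrightarrow> (\<forall>\<phi>::real \<times> (real^2) \<Rightarrow> real. test_fun \<phi> \<longrightarrow>
     (let dt = (\<lambda>t. \<integral>x. frechet_derivative \<phi> (at (t, x)) (1, 0) \<partial>(\<mu> t));
          adv = (\<lambda>t. \<integral>x. frechet_derivative \<phi> (at (t, x)) (0, u t x) \<partial>(\<mu> t))
      in set_integrable lborel {0..T} dt \<and> set_integrable lborel {0..T} adv \<and>
         (LINT t:{0..T}|lborel. dt t) - (\<integral>x. \<phi> (T, x) \<partial>(\<mu> T))
           + (\<integral>x. \<phi> (0, x) \<partial>(\<mu> 0)) + (LINT t:{0..T}|lborel. adv t) = 0))"

definition locally_finite_borel :: "(real^2) measure \<Rightarrow> bool" where
  "locally_finite_borel M \<longleftrightarrow> sets M = sets borel \<and>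
     (\<forall>K. compact K \<longrightarrow> emeasure M K < \<infinity>)"

definition measure_support :: "'a::metric_space measure \<Rightarrow> 'a set" where
  "measure_support M = {x. \<forall>r>0. emeasure M (ball x r) > 0}"

definition hausdorff_pre :: "real \<Rightarrow> real \<Rightarrow> 'a::metric_space set \<Rightarrow> ennreal" where
  "hausdorff_pre s \<delta> A = (INF C \<in> {C :: nat \<Rightarrow> 'a set. A \<subseteq> (\<Union>i. C i) \<and>
       (\<forall>i. bounded (C i) \<and> diameter (C i) \<le> \<delta>)}. \<Sum>i. ennreal (diameter (C i) powr s))"

definition hausdorff_measure :: "real \<Rightarrow> 'a::metric_space set \<Rightarrow> ennreal" where
  "hausdorff_measure s A = (SUP \<delta> \<in> {0<..}. hausdorff_pre s \<delta> A)"

definition hausdorff_dim :: "'a::metric_space set \<Rightarrow> real" where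
  "hausdorff_dim A = Inf {s. s > 0 \<and> hausdorff_measure s A = 0}"

definition locally_lipschitz_on :: "'a::metric_space set \<Rightarrow> ('a \<Rightarrow> 'b::metric_space) \<Rightarrow> bool" where
  "locally_lipschitz_on S f \<longleftrightarrow> (\<forall>p\<in>S. \<exists>r>0. \<exists>L. L-lipschitz_on (ball p r \<inter> S) f)"

end

theory Submission
  imports Defs
begin

text \<open>
  Let \<open>r = 4 powr (-1/h) < 1/2\<close>. At time \<open>1\<close> the measure is the uniform measure on the planar Cantor
  set of all \<open>\<Sum>k. r ^ Suc k *\<^sub>R (e k, e' k)\<close> with signs \<open>e k\<close>, \<open>e' k\<close>, whose dimension is \<open>h\<close>. Backwards in
  time, during the stage between \<open>1 / (n + 1)\<close> and \<open>1 / (n + 2)\<close>, the \<open>4 ^ (n + 1)\<close> Cantor squares of that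
  level move rigidly, while their centres form a uniform grid that is contracted homothetically by the
  factor \<open>2 * r < 1\<close>. At the end of the stage the squares are still disjoint, and their subsquares form the
  next finer uniform grid, so the motion can go on; at time \<open>0\<close> everything has been swept into the origin.
  The step is possible without changing areas because the squares only translate.

  If \<open>S\<close> is a smooth staircase that is constant on the intervals occupied by the squares, the stream
  function \<open>y * S x - x * S y\<close> generates exactly this motion: its velocity \<open>(S x - x * S' y, S y - y * S' x)\<close>
  equals the centre of the square containing \<open>(x, y)\<close>. Rescaled by \<open>scale t\<close> the velocity is of size
  \<open>scale' t\<close>, which tends to \<open>0\<close> at time \<open>0\<close>; it is Lipschitz for positive times, so that it is enough to
  follow the individual trajectories.
\<close>

section \<open>Functions that are Lipschitz near a point\<close>

text \<open>At time 0 a single point splits into uncountably many trajectories, so the field cannot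
  be Lipschitz at the space-time origin, and continuity there is the delicate point. Contracting by
  \<open>2 * r\<close> once per unit of \<open>1 / t\<close> makes \<open>scale\<close> of size
  \<open>exp (- rate / t)\<close>; differentiation costs a factor \<open>1 / t^2\<close>, yet the
  speed still tends to 0. Since the grids become finer without limit, the shape of the field must be
  bounded independently of the stage: a staircase of mesh \<open>d <= 1\<close> stays within
  \<open>4 * d\<close> of the identity, and its slope does not depend on \<open>d\<close>, because
  the free margin around a square is a fixed fraction of its cell. That margin is positive exactly
  because \<open>r < 1/2\<close>. No flow is constructed. Each label in \<open>{0..<1}\<close> gets
  an explicit trajectory, its binary digits being the signs, and the measure is the image of
  Lebesgue measure on the labels. The weak equation is then the chain rule along each trajectory,
  averaged over the labels. At a positive time all but finitely many digits are frozen at their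
  final weights \<open>r ^ Suc k\<close>, which is why the dimension does not depend on the
  time.\<close>

definition lipschitz_near :: "('a::metric_space \<Rightarrow> 'b::metric_space) \<Rightarrow> 'a \<Rightarrow> bool" where
  "lipschitz_near f p \<longleftrightarrow> (\<exists>d>0. \<exists>L. L-lipschitz_on (ball p d) f)"

lemma lipschitz_nearI:
  assumes "d > 0" "\<And>x y. x \<in> ball p d \<Longrightarrow> y \<in> ball p d \<Longrightarrow> dist (f x) (f y) \<le> L * dist x y"
  shows "lipschitz_near f p"
proof -
  have "\<bar>L\<bar>-lipschitz_on (ball p d) f"
  proof (rule lipschitz_onI)
    fix x y assume "x \<in> ball p d" "y \<in> ball p d"
    then have "dist (f x) (f y) \<le> L * dist x y" by (rule assms(2))
    also have "\<dots> \<le> \<bar>L\<bar> * dist x y" by (intro mult_right_mono) auto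
    finally show "dist (f x) (f y) \<le> \<bar>L\<bar> * dist x y" .
  qed simp
  then show ?thesis using assms(1) unfolding lipschitz_near_def by blast
qed

lemma lipschitz_nearE:
  assumes "lipschitz_near f p"
  obtains d L where "d > 0" "L > 0"
    "\<And>x y. x \<in> ball p d \<Longrightarrow> y \<in> ball p d \<Longrightarrow> dist (f x) (f y) \<le> L * dist x y"
proof -
  obtain d L where d: "d > 0" and L: "L-lipschitz_on (ball p d) f"
    using assms unfolding lipschitz_near_def by blast
  have L0: "0 \<le> L" using L by (rule lipschitz_on_nonneg)
  show ?thesis
  proof (rule that[of d "L+1"])
    fix x y assume "x \<in> ball p d" "y \<in> ball p d"
    then have "dist (f x) (f y) \<le> L * dist x y" by (rule lipschitz_onD[OF L])
    also have "\<dots> \<le> (L+1) * dist x y" by (intro mult_right_mono) auto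
    finally show "dist (f x) (f y) \<le> (L+1) * dist x y" .
  qed (use d L0 in auto)
qed

lemma lipschitz_near_cong:
  assumes "lipschitz_near f p" "eventually (\<lambda>x. f x = g x) (nhds p)"
  shows "lipschitz_near g p"
proof -
  obtain d L where d: "d > 0" "\<And>x y. x \<in> ball p d \<Longrightarrow> y \<in> ball p d \<Longrightarrow> dist (f x) (f y) \<le> L * dist x y"
    using assms(1) by (rule lipschitz_nearE) blast
  obtain e where e: "e > 0" "\<And>x. dist x p < e \<Longrightarrow> f x = g x"
    using assms(2) unfolding eventually_nhds_metric by blast
  show ?thesis
  proof (rule lipschitz_nearI[of "min d e"])
    fix x y assume "x \<in> ball p (min d e)" "y \<in> ball p (min d e)"
    then show "dist (g x) (g y) \<le> L * dist x y"
      using d(2)[of x y] e(2)[of x] e(2)[of y] by (simp add: dist_commute)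
  qed (use d e in auto)
qed

lemma lipschitz_near_compose:
  assumes "lipschitz_near f p" "lipschitz_near g (f p)"
  shows "lipschitz_near (\<lambda>x. g (f x)) p"
proof -
  obtain d L where d: "d > 0" "L > 0"
    "\<And>x y. x \<in> ball p d \<Longrightarrow> y \<in> ball p d \<Longrightarrow> dist (f x) (f y) \<le> L * dist x y"
    using assms(1) by (rule lipschitz_nearE) blast
  obtain e K where e: "e > 0" "K > 0"
    "\<And>x y. x \<in> ball (f p) e \<Longrightarrow> y \<in> ball (f p) e \<Longrightarrow> dist (g x) (g y) \<le> K * dist x y"
    using assms(2) by (rule lipschitz_nearE) blast
  show ?thesis
  proof (rule lipschitz_nearI[of "min d (e/L)"])
    have *: "f x \<in> ball (f p) e" if "x \<in> ball p (min d (e/L))" for x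
    proof -
      have "dist (f p) (f x) \<le> L * dist p x" using that d by auto
      also have "\<dots> < L * (e/L)" using that d by (intro mult_strict_left_mono) auto
      finally show ?thesis using d by simp
    qed
    fix x y assume xy: "x \<in> ball p (min d (e/L))" "y \<in> ball p (min d (e/L))"
    have "dist (g (f x)) (g (f y)) \<le> K * dist (f x) (f y)" using *[OF xy(1)] *[OF xy(2)] by (rule e(3))
    also have "\<dots> \<le> K * (L * dist x y)" using d(3)[of x y] xy e(2) by (intro mult_left_mono) auto
    finally show "dist (g (f x)) (g (f y)) \<le> K * L * dist x y" by simp
  qed (use d e in auto)
qed

lemma lipschitz_near_imp_isCont:
  assumes "lipschitz_near f p" shows "isCont f p"
proof -
  obtain d L where d: "d > 0" "L-lipschitz_on (ball p d) f"
    using assms unfolding lipschitz_near_def by blast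
  have "continuous_on (ball p d) f" using d(2) by (rule lipschitz_on_continuous_on)
  then show ?thesis using d(1) by (simp add: continuous_on_eq_continuous_at)
qed

lemma lipschitz_near_const: "lipschitz_near (\<lambda>x. c) p"
  by (rule lipschitz_nearI[of 1 _ _ 0]) auto

lemma lipschitz_near_add:
  fixes f g :: "'a::metric_space \<Rightarrow> 'b::real_normed_vector"
  assumes "lipschitz_near f p" "lipschitz_near g p"
  shows "lipschitz_near (\<lambda>x. f x + g x) p"
proof -
  obtain d L where d: "d > 0" "L > 0"
    "\<And>x y. x \<in> ball p d \<Longrightarrow> y \<in> ball p d \<Longrightarrow> dist (f x) (f y) \<le> L * dist x y"
    using assms(1) by (rule lipschitz_nearE) blast
  obtain e K where e: "e > 0" "K > 0"
    "\<And>x y. x \<in> ball p e \<Longrightarrow> y \<in> ball p e \<Longrightarrow> dist (g x) (g y) \<le> K * dist x y"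
    using assms(2) by (rule lipschitz_nearE) blast
  show ?thesis
  proof (rule lipschitz_nearI[of "min d e"])
    fix x y assume xy: "x \<in> ball p (min d e)" "y \<in> ball p (min d e)"
    have "dist (f x + g x) (f y + g y) \<le> dist (f x) (f y) + dist (g x) (g y)"
      by (rule dist_triangle_add)
    then show "dist (f x + g x) (f y + g y) \<le> (L + K) * dist x y"
      using d(3)[of x y] e(3)[of x y] xy by (simp add: algebra_simps)
  qed (use d e in auto)
qed

lemma lipschitz_near_mult:
  fixes f g :: "'a::metric_space \<Rightarrow> real"
  assumes "lipschitz_near f p" "lipschitz_near g p"
  shows "lipschitz_near (\<lambda>x. f x * g x) p"
proof -
  obtain d L where d: "d > 0" "L > 0"
    "\<And>x y. x \<in> ball p d \<Longrightarrow> y \<in> ball p d \<Longrightarrow> dist (f x) (f y) \<le> L * dist x y"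
    using assms(1) by (rule lipschitz_nearE) blast
  obtain e K where e: "e > 0" "K > 0"
    "\<And>x y. x \<in> ball p e \<Longrightarrow> y \<in> ball p e \<Longrightarrow> dist (g x) (g y) \<le> K * dist x y"
    using assms(2) by (rule lipschitz_nearE) blast
  define A where "A = \<bar>f p\<bar> + L * d"
  define B where "B = \<bar>g p\<bar> + K * e"
  show ?thesis
  proof (rule lipschitz_nearI[of "min d e"])
    fix x y assume xy: "x \<in> ball p (min d e)" "y \<in> ball p (min d e)"
    have "\<bar>f x - f p\<bar> \<le> L * dist x p" using d(3)[of x p] xy d(1) by (auto simp: dist_real_def)
    also have "\<dots> \<le> L * d" using xy d by (intro mult_left_mono) (auto simp: dist_commute)
    finally have A: "\<bar>f x\<bar> \<le> A" unfolding A_def by linarith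
    have "\<bar>g y - g p\<bar> \<le> K * dist y p" using e(3)[of y p] xy e(1) by (auto simp: dist_real_def)
    also have "\<dots> \<le> K * e" using xy e by (intro mult_left_mono) (auto simp: dist_commute)
    finally have B: "\<bar>g y\<bar> \<le> B" unfolding B_def by linarith
    have "\<bar>f x * g x - f y * g y\<bar> = \<bar>f x * (g x - g y) + g y * (f x - f y)\<bar>"
      by (simp add: algebra_simps)
    also have "\<dots> \<le> \<bar>f x\<bar> * \<bar>g x - g y\<bar> + \<bar>g y\<bar> * \<bar>f x - f y\<bar>"
      by (metis abs_mult abs_triangle_ineq)
    also have "\<dots> \<le> A * (K * dist x y) + B * (L * dist x y)"
      using A B d(3)[of x y] e(3)[of x y] xy by (intro add_mono mult_mono) (auto simp: dist_real_def)
    finally show "dist (f x * g x) (f y * g y) \<le> (A * K + B * L) * dist x y"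
      by (simp add: dist_real_def algebra_simps)
  qed (use d e in auto)
qed

lemma lipschitz_near_diff:
  fixes f g :: "'a::metric_space \<Rightarrow> real"
  assumes "lipschitz_near f p" "lipschitz_near g p"
  shows "lipschitz_near (\<lambda>x. f x - g x) p"
  using lipschitz_near_add[OF assms(1) lipschitz_near_mult[OF lipschitz_near_const[of "-1"] assms(2)]]
  by simp

lemma lipschitz_near_sum:
  fixes f :: "'i \<Rightarrow> 'a::metric_space \<Rightarrow> 'b::real_normed_vector"
  assumes "\<And>i. i \<in> I \<Longrightarrow> lipschitz_near (f i) p"
  shows "lipschitz_near (\<lambda>x. \<Sum>i\<in>I. f i x) p"
  using assms by (induction I rule: infinite_finite_induct)
    (auto intro: lipschitz_near_const lipschitz_near_add)

lemma lipschitz_near_bounded_linear: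
  assumes "bounded_linear f" shows "lipschitz_near f p"
proof -
  obtain K where K: "\<And>x. norm (f x) \<le> norm x * K" using bounded_linear.bounded[OF assms] by blast
  show ?thesis
    by (rule lipschitz_nearI[of 1 _ _ K])
      (use K in \<open>auto simp: dist_norm mult.commute linear_diff[OF bounded_linear.linear[OF assms], symmetric]\<close>)
qed

lemma lipschitz_near_max_min:
  "lipschitz_near (\<lambda>x::real. max a (min b x)) p"
  by (rule lipschitz_nearI[of 1 _ _ 1]) (auto simp: dist_real_def)

lemma lipschitz_near_C1:
  fixes f f' :: "real \<Rightarrow> real"
  assumes "open S" "p \<in> S" "\<And>x. x \<in> S \<Longrightarrow> (f has_real_derivative f' x) (at x)" "continuous_on S f'"
  shows "lipschitz_near f p"
proof -
  obtain d where d: "d > 0" "cball p d \<subseteq> S" using assms(1,2) open_contains_cball by blast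
  have "bounded (f' ` cball p d)"
    by (intro compact_imp_bounded compact_continuous_image continuous_on_subset[OF assms(4) d(2)]) simp
  then obtain B where B: "\<And>x. x \<in> cball p d \<Longrightarrow> norm (f' x) \<le> B" unfolding bounded_iff by blast
  show ?thesis
  proof (rule lipschitz_nearI[OF d(1)])
    fix x y assume xy: "x \<in> ball p d" "y \<in> ball p d"
    have "norm (f x - f y) \<le> B * norm (x - y)"
    proof (rule field_differentiable_bound[of "cball p d" f f'])
      show "(f has_field_derivative f' z) (at z within cball p d)" if "z \<in> cball p d" for z
        using assms(3) that d(2) by (blast intro: has_field_derivative_at_within)
    qed (use B xy in auto)
    then show "dist (f x) (f y) \<le> B * dist x y" by (simp add: dist_norm)
  qed
qed

lemma has_real_derivative_zero_compose:
  fixes f g :: "real \<Rightarrow> real"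
  assumes "(f has_real_derivative 0) (at (g c))" "\<And>y. \<bar>g y - g c\<bar> \<le> \<bar>y - c\<bar>"
  shows "((\<lambda>y. f (g y)) has_real_derivative 0) (at c)"
  unfolding has_field_derivative_def has_derivative_at_alt
proof (intro conjI allI impI)
  show "bounded_linear ((*) (0::real))" by (rule bounded_linear_mult_right)
  fix e :: real assume e: "e > 0"
  have "(f has_derivative (*) 0) (at (g c))" using assms(1) by (simp add: has_field_derivative_def)
  then obtain d where d: "d > 0" "\<And>y. norm (y - g c) < d \<Longrightarrow> norm (f y - f (g c) - 0 * (y - g c)) \<le> e * norm (y - g c)"
    using e unfolding has_derivative_at_alt by blast
  have "norm (f (g y) - f (g c) - 0 * (y - c)) \<le> e * norm (y - c)" if "norm (y - c) < d" for y
  proof -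
    have "norm (g y - g c) < d" using assms(2)[of y] that by simp
    from d(2)[OF this] have "norm (f (g y) - f (g c)) \<le> e * norm (g y - g c)" by simp
    also have "\<dots> \<le> e * norm (y - c)" using e assms(2)[of y] by (intro mult_left_mono) auto
    finally show ?thesis by simp
  qed
  then show "\<exists>d>0. \<forall>y. norm (y - c) < d \<longrightarrow> norm (f (g y) - f (g c) - 0 * (y - c)) \<le> e * norm (y - c)"
    using d(1) by blast
qed

text \<open>The outer derivative vanishes at both corners of the clamp, so they disappear. This
  glues a polynomial to its constant continuations without one-sided derivatives.\<close>

lemma has_real_derivative_max_min:
  fixes f f' :: "real \<Rightarrow> real"
  assumes "a < b" "f' a = 0" "f' b = 0"
    "(f has_real_derivative f' (max a (min b x))) (at (max a (min b x)))"
  shows "((\<lambda>x. f (max a (min b x))) has_real_derivative f' (max a (min b x))) (at x)"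
proof (cases "a < x \<and> x < b")
  case True
  then have x: "max a (min b x) = x" by auto
  have "\<forall>\<^sub>F y in nhds x. y \<in> {a<..<b}" using True by (intro eventually_nhds_in_open) auto
  then have "\<forall>\<^sub>F y in nhds x. f (max a (min b y)) = f y" by eventually_elim auto
  then show ?thesis using assms(4) x by (simp add: DERIV_cong_ev)
next
  case False
  then have "f' (max a (min b x)) = 0" using assms(1-3) by (auto simp: max_def min_def)
  then show ?thesis using assms(4) has_real_derivative_zero_compose[of f "\<lambda>x. max a (min b x)" x] by simp
qed

lemma has_real_derivative_min:
  fixes f f' :: "real \<Rightarrow> real"
  assumes "f' c = 0" "(f has_real_derivative f' (min x c)) (at (min x c))"
  shows "((\<lambda>x. f (min x c)) has_real_derivative f' (min x c)) (at x)"
proof (cases "x < c")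
  case True
  have "\<forall>\<^sub>F y in nhds x. y \<in> {..<c}" using True by (intro eventually_nhds_in_open) auto
  then have "\<forall>\<^sub>F y in nhds x. f (min y c) = f y" by eventually_elim auto
  then show ?thesis using assms(2) True by (simp add: DERIV_cong_ev)
next
  case False
  then have "f' (min x c) = 0" using assms by (auto simp: min_def)
  then show ?thesis using assms(2) has_real_derivative_zero_compose[of f "\<lambda>x. min x c" x] by simp
qed

section \<open>Smooth staircases\<close>

text \<open>The cubic whose derivative is proportional to \<open>b^2 - v^2\<close>; the factor
  \<open>3 / (4 * b)\<close> makes the total rise between \<open>-b\<close> and \<open>b\<close>
  equal to 1. As the slope vanishes at the ends, the clamped function is C^1 with Lipschitz
  derivative, which is all the smoothness asked of the staircase.\<close>

definition step :: "real \<Rightarrow> real \<Rightarrow> real" where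
  "step b w = (let v = max (- b) (min b w) in 3 / (4 * b) * (v - v ^ 3 / (3 * b\<^sup>2)))"

definition step' :: "real \<Rightarrow> real \<Rightarrow> real" where
  "step' b w = 3 / (4 * b) * (1 - (max (- b) (min b w))\<^sup>2 / b\<^sup>2)"

lemma step_saturated:
  assumes "b > 0"
  shows "w \<ge> b \<Longrightarrow> step b w = 1/2" "w \<le> - b \<Longrightarrow> step b w = - (1/2)"
    "\<bar>w\<bar> \<ge> b \<Longrightarrow> step' b w = 0"
proof -
  show "step b w = 1/2" if "w \<ge> b"
  proof -
    have "max (- b) (min b w) = b" using that assms by auto
    then show ?thesis using assms unfolding step_def Let_def by (simp add: field_simps power2_eq_square power3_eq_cube)
  qed
  show "step b w = - (1/2)" if "w \<le> - b"
  proof -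
    have "max (- b) (min b w) = - b" using that assms by auto
    then show ?thesis using assms unfolding step_def Let_def by (simp add: field_simps power2_eq_square power3_eq_cube)
  qed
  show "step' b w = 0" if "\<bar>w\<bar> \<ge> b"
  proof -
    have "max (- b) (min b w) = b \<or> max (- b) (min b w) = - b" using that assms by auto
    then show ?thesis using assms unfolding step'_def by auto
  qed
qed

lemma abs_step_le:
  assumes "b > 0" shows "\<bar>step b w\<bar> \<le> 1"
proof -
  define v where "v = max (- b) (min b w)"
  have v: "\<bar>v\<bar> \<le> b" using assms unfolding v_def by auto
  have "\<bar>v ^ 3\<bar> \<le> b ^ 3" using v by (simp add: power_abs power_mono)
  then have "\<bar>v ^ 3 / (3 * b\<^sup>2)\<bar> \<le> b ^ 3 / (3 * b\<^sup>2)" using assms by (simp add: divide_right_mono)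
  also have "\<dots> = b / 3" using assms by (simp add: power2_eq_square power3_eq_cube)
  finally have "\<bar>v - v ^ 3 / (3 * b\<^sup>2)\<bar> \<le> b + b / 3" using v by linarith
  then have "3 / (4 * b) * \<bar>v - v ^ 3 / (3 * b\<^sup>2)\<bar> \<le> 3 / (4 * b) * (b + b / 3)"
    using assms by (intro mult_left_mono) auto
  also have "\<dots> = 1" using assms by (simp add: field_simps)
  finally have "\<bar>3 / (4 * b)\<bar> * \<bar>v - v ^ 3 / (3 * b\<^sup>2)\<bar> \<le> 1" using assms by simp
  then show ?thesis by (simp only: step_def v_def[symmetric] abs_mult Let_def)
qed

lemma abs_step'_le:
  assumes "b > 0" shows "\<bar>step' b w\<bar> \<le> 3 / (4 * b)"
proof -
  define v where "v = max (- b) (min b w)"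
  have v: "\<bar>v\<bar> \<le> b" using assms unfolding v_def by auto
  have "v\<^sup>2 \<le> b\<^sup>2" using v assms by (simp add: abs_le_square_iff[symmetric])
  then have "\<bar>1 - v\<^sup>2 / b\<^sup>2\<bar> \<le> 1" using assms by (simp add: abs_le_iff)
  then have "3 / (4 * b) * \<bar>1 - v\<^sup>2 / b\<^sup>2\<bar> \<le> 3 / (4 * b) * 1"
    using assms by (intro mult_left_mono) auto
  then have "\<bar>3 / (4 * b)\<bar> * \<bar>1 - v\<^sup>2 / b\<^sup>2\<bar> \<le> 3 / (4 * b)" using assms by simp
  then show ?thesis by (simp only: step'_def v_def[symmetric] abs_mult)
qed

lemma has_real_derivative_step:
  assumes "b > 0" shows "(step b has_real_derivative step' b w) (at w)"
proof -
  define f where "f = (\<lambda>v. 3 / (4 * b) * (v - v ^ 3 / (3 * b\<^sup>2)))"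
  define f' where "f' = (\<lambda>v. 3 / (4 * b) * (1 - v\<^sup>2 / b\<^sup>2))"
  have "(f has_real_derivative f' v) (at v)" for v
    unfolding f_def f'_def using assms by (auto intro!: derivative_eq_intros simp: power2_eq_square field_simps)
  then have "((\<lambda>x. f (max (- b) (min b x))) has_real_derivative f' (max (- b) (min b w))) (at w)"
    using assms by (intro has_real_derivative_max_min) (auto simp: f'_def)
  moreover have "(\<lambda>x. f (max (- b) (min b x))) = step b"
    by (auto simp: f_def step_def Let_def)
  ultimately show ?thesis by (simp add: f'_def step'_def)
qed

lemma lipschitz_near_step': "lipschitz_near (step' b) p"
  unfolding step'_def power2_eq_square divide_inverse
  by (intro lipschitz_near_mult lipschitz_near_diff lipschitz_near_const lipschitz_near_max_min)

text \<open>A unit jump at each integer, smeared over a width \<open>2 * b\<close>, with value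
  \<open>j + 1/2\<close> between the jumps at \<open>j\<close> and \<open>j + 1\<close>. Besides the
  jump at the floor of \<open>z\<close> the next one must be counted, because it already begins to
  the left of its integer.\<close>

definition staircase :: "real \<Rightarrow> real \<Rightarrow> real" where
  "staircase b z = real_of_int \<lfloor>z\<rfloor> + 1/2 + step b (z - real_of_int \<lfloor>z\<rfloor>) + step b (z - real_of_int \<lfloor>z\<rfloor> - 1)"

definition staircase' :: "real \<Rightarrow> real \<Rightarrow> real" where
  "staircase' b z = step' b (z - real_of_int \<lfloor>z\<rfloor>) + step' b (z - real_of_int \<lfloor>z\<rfloor> - 1)"

text \<open>Freezing the floor at \<open>m\<close> on an interval that reaches 1/2 beyond both ends
  gives a formula valid in a neighbourhood of every point, integers included. On the overlaps the
  jumps that are counted or omitted are saturated, since \<open>b < 1/2\<close>.\<close>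

lemma staircase_local:
  assumes b: "0 < b" "b < 1/2" and z: "real_of_int m - 1/2 < z" "z < m + 3/2"
  shows "staircase b z = m + 1/2 + step b (z - m) + step b (z - m - 1)"
    "staircase' b z = step' b (z - m) + step' b (z - m - 1)"
proof -
  have "\<lfloor>z\<rfloor> = m \<or> \<lfloor>z\<rfloor> = m - 1 \<or> \<lfloor>z\<rfloor> = m + 1" using z by linarith
  then consider "\<lfloor>z\<rfloor> = m" | "\<lfloor>z\<rfloor> = m - 1" | "\<lfloor>z\<rfloor> = m + 1" by blast
  then have "staircase b z = m + 1/2 + step b (z - m) + step b (z - m - 1) \<and>
    staircase' b z = step' b (z - m) + step' b (z - m - 1)"
  proof cases
    case 1 then show ?thesis by (simp add: staircase_def staircase'_def)
  next
    case 2
    have "step b (z - (real_of_int m - 1)) = 1/2" "step b (z - m - 1) = - (1/2)"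
      "step' b (z - (real_of_int m - 1)) = 0" "step' b (z - m - 1) = 0"
      using z b 2 by (intro step_saturated; linarith)+
    then show ?thesis using 2 by (simp add: staircase_def staircase'_def)
  next
    case 3
    have "z \<ge> m + 1" using 3 by linarith
    moreover from this have "step b (z - m) = 1/2" "step b (z - m - 2) = - (1/2)"
      "step' b (z - m) = 0" "step' b (z - m - 2) = 0"
      using z b by (intro step_saturated; linarith)+
    moreover have "z - real_of_int \<lfloor>z\<rfloor> = z - real_of_int m - 1" using 3 by simp
    moreover have "z - real_of_int \<lfloor>z\<rfloor> - 1 = z - real_of_int m - 2" using 3 by simp
    ultimately show ?thesis using 3 by (simp add: staircase_def staircase'_def diff_diff_eq add.commute)
  qed
  then show "staircase b z = m + 1/2 + step b (z - m) + step b (z - m - 1)"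
    "staircase' b z = step' b (z - m) + step' b (z - m - 1)" by auto
qed

lemma eventually_near_floor: "\<forall>\<^sub>F y in nhds z. real_of_int \<lfloor>z\<rfloor> - 1/2 < y \<and> y < real_of_int \<lfloor>z\<rfloor> + 3/2"
proof -
  have "z \<in> {real_of_int \<lfloor>z\<rfloor> - 1/2 <..< real_of_int \<lfloor>z\<rfloor> + 3/2}" by simp linarith
  then have "\<forall>\<^sub>F y in nhds z. y \<in> {real_of_int \<lfloor>z\<rfloor> - 1/2 <..< real_of_int \<lfloor>z\<rfloor> + 3/2}"
    by (intro eventually_nhds_in_open) auto
  then show ?thesis by simp
qed

lemma has_real_derivative_staircase:
  assumes b: "0 < b" "b < 1/2"
  shows "(staircase b has_real_derivative staircase' b z) (at z)"
proof -
  define m where "m = \<lfloor>z\<rfloor>"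
  have "\<forall>\<^sub>F y in nhds z. staircase b y = m + 1/2 + step b (y - m) + step b (y - m - 1)"
    using eventually_near_floor[of z] by eventually_elim (auto simp: m_def intro: staircase_local[OF b])
  moreover have "((\<lambda>y. m + 1/2 + step b (y - m) + step b (y - m - 1)) has_real_derivative
      step' b (z - m) + step' b (z - m - 1)) (at z)"
    using b(1) by (auto intro!: derivative_eq_intros DERIV_chain2[OF has_real_derivative_step])
  ultimately show ?thesis unfolding staircase'_def m_def by (simp add: DERIV_cong_ev)
qed

lemma lipschitz_near_staircase':
  assumes b: "0 < b" "b < 1/2" shows "lipschitz_near (staircase' b) z"
proof -
  define m where "m = real_of_int \<lfloor>z\<rfloor>"
  have *: "lipschitz_near (\<lambda>y. step' b (y - c)) z" for c
    by (intro lipschitz_near_compose[where g = "step' b", OF _ lipschitz_near_step'] lipschitz_near_diff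
        lipschitz_near_const lipschitz_near_bounded_linear bounded_linear_ident)
  have "lipschitz_near (\<lambda>y. step' b (y - m) + step' b (y - (m + 1))) z"
    by (intro lipschitz_near_add *)
  moreover have "\<forall>\<^sub>F y in nhds z. step' b (y - m) + step' b (y - (m + 1)) = staircase' b y"
    using eventually_near_floor[of z]
    by eventually_elim (auto simp: m_def staircase_local(2)[OF b] diff_diff_eq)
  ultimately show ?thesis by (rule lipschitz_near_cong)
qed

lemma abs_staircase_diff_le:
  assumes "b > 0" shows "\<bar>staircase b z - z\<bar> \<le> 4"
proof -
  have "z - 1 \<le> real_of_int \<lfloor>z\<rfloor>" "real_of_int \<lfloor>z\<rfloor> \<le> z" by linarith+
  then show ?thesis unfolding staircase_def
    using abs_step_le[OF assms, of "z - real_of_int \<lfloor>z\<rfloor>"] abs_step_le[OF assms, of "z - real_of_int \<lfloor>z\<rfloor> - 1"] by linarith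
qed

lemma abs_staircase'_le:
  assumes "b > 0" shows "\<bar>staircase' b z\<bar> \<le> 3 / (2 * b)"
  unfolding staircase'_def
  using abs_step'_le[OF assms, of "z - real_of_int \<lfloor>z\<rfloor>"] abs_step'_le[OF assms, of "z - real_of_int \<lfloor>z\<rfloor> - 1"]
  by (simp add: field_simps)

lemma staircase_plateau:
  assumes b: "0 < b" "b < 1/2" and z: "\<bar>z - (real_of_int j + 1/2)\<bar> \<le> 1/2 - b"
  shows "staircase b z = j + 1/2" "staircase' b z = 0"
proof -
  have *: "real_of_int j - 1/2 < z" "z < j + 3/2" using z b by linarith+
  have "step b (z - j) = 1/2" "step b (z - j - 1) = - (1/2)"
      "step' b (z - j) = 0" "step' b (z - j - 1) = 0"
      using z b by (intro step_saturated; linarith)+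
  then show "staircase b z = j + 1/2" "staircase' b z = 0"
    using staircase_local[OF b *] by auto
qed

text \<open>Using \<open>x^2\<close> instead of the absolute value avoids a corner at 0. The
  transition runs over \<open>x^2\<close> from 1 to 2, centred at 3/2 with half-width 1/2.\<close>

definition cutoff :: "real \<Rightarrow> real" where
  "cutoff x = 1/2 - step (1/2) (x\<^sup>2 - 3/2)"

definition cutoff' :: "real \<Rightarrow> real" where
  "cutoff' x = - step' (1/2) (x\<^sup>2 - 3/2) * (2 * x)"

lemma cutoff_inner:
  assumes "\<bar>x\<bar> \<le> 1" shows "cutoff x = 1" "cutoff' x = 0"
proof -
  have "x\<^sup>2 \<le> 1" using assms by (simp add: abs_square_le_1)
  then show "cutoff x = 1" "cutoff' x = 0"
    unfolding cutoff_def cutoff'_def by (auto simp: step_saturated)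
qed

lemma cutoff_outer:
  assumes "\<bar>x\<bar> \<ge> 2" shows "cutoff x = 0" "cutoff' x = 0"
proof -
  have "\<bar>x\<bar>\<^sup>2 \<ge> 2\<^sup>2" using assms by (intro power_mono) auto
  then show "cutoff x = 0" "cutoff' x = 0"
    unfolding cutoff_def cutoff'_def by (auto simp: step_saturated)
qed

lemma abs_cutoff_le: "\<bar>cutoff x\<bar> \<le> 3/2"
  unfolding cutoff_def using abs_step_le[of "1/2" "x\<^sup>2 - 3/2"] by linarith

lemma abs_cutoff'_le: "\<bar>cutoff' x\<bar> \<le> 6"
proof (cases "\<bar>x\<bar> \<ge> 2")
  case False
  have "\<bar>step' (1/2) (x\<^sup>2 - 3/2)\<bar> * \<bar>2 * x\<bar> \<le> (3/2) * 4"
    using abs_step'_le[of "1/2" "x\<^sup>2 - 3/2"] False by (intro mult_mono) auto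
  then show ?thesis by (simp add: cutoff'_def abs_mult)
qed (simp add: cutoff_outer)

lemma has_real_derivative_cutoff: "(cutoff has_real_derivative cutoff' x) (at x)"
  unfolding cutoff_def[abs_def] cutoff'_def
  by (auto intro!: derivative_eq_intros DERIV_chain2[OF has_real_derivative_step])

lemma lipschitz_near_id: "lipschitz_near (\<lambda>x::real. x) p"
  by (intro lipschitz_near_bounded_linear bounded_linear_ident)

lemma lipschitz_near_cutoff': "lipschitz_near cutoff' p"
proof -
  have "lipschitz_near (\<lambda>x. (-2) * (step' (1/2) (x * x - 3/2) * x)) p"
    by (intro lipschitz_near_mult lipschitz_near_const lipschitz_near_id
        lipschitz_near_compose[where g = "step' (1/2)", OF _ lipschitz_near_step'] lipschitz_near_diff)
  moreover have "(\<lambda>x. (-2) * (step' (1/2) (x * x - 3/2) * x)) = cutoff'"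
    by (auto simp: cutoff'_def power2_eq_square)
  ultimately show ?thesis by simp
qed

section \<open>Truncated stream function and its velocity\<close>

definition cut_id :: "real \<Rightarrow> real" where "cut_id x = x * cutoff x"
definition cut_id' :: "real \<Rightarrow> real" where "cut_id' x = cutoff x + x * cutoff' x"

definition cut_stair :: "real \<Rightarrow> real \<Rightarrow> real \<Rightarrow> real" where
  "cut_stair b d x = cutoff x * (d * staircase b (x / d))"

definition cut_stair' :: "real \<Rightarrow> real \<Rightarrow> real \<Rightarrow> real" where
  "cut_stair' b d x = cutoff' x * (d * staircase b (x / d)) + cutoff x * staircase' b (x / d)"

lemma has_real_derivative_cut_id: "(cut_id has_real_derivative cut_id' x) (at x)"
  unfolding cut_id_def[abs_def] cut_id'_def
  by (auto intro!: derivative_eq_intros has_real_derivative_cutoff)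

lemma has_real_derivative_cut_stair:
  assumes "0 < b" "b < 1/2" "d > 0"
  shows "(cut_stair b d has_real_derivative cut_stair' b d x) (at x)"
  unfolding cut_stair_def[abs_def] cut_stair'_def using assms
  by (auto intro!: derivative_eq_intros has_real_derivative_cutoff
      DERIV_chain2[OF has_real_derivative_staircase])

lemma lipschitz_near_C1_UNIV:
  fixes f f' :: "real \<Rightarrow> real"
  assumes "\<And>x. (f has_real_derivative f' x) (at x)" "\<And>x. lipschitz_near f' x"
  shows "lipschitz_near f p"
  using assms by (intro lipschitz_near_C1[of UNIV])
    (auto simp: continuous_on_eq_continuous_at lipschitz_near_imp_isCont)

lemma lipschitz_near_cutoff: "lipschitz_near cutoff p"
  using has_real_derivative_cutoff lipschitz_near_cutoff' by (rule lipschitz_near_C1_UNIV)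

lemma lipschitz_near_staircase:
  assumes "0 < b" "b < 1/2" shows "lipschitz_near (staircase b) p"
  using has_real_derivative_staircase[OF assms] lipschitz_near_staircase'[OF assms]
  by (rule lipschitz_near_C1_UNIV)

lemma lipschitz_near_cut_id': "lipschitz_near cut_id' p"
  unfolding cut_id'_def[abs_def]
  by (intro lipschitz_near_add lipschitz_near_mult lipschitz_near_id lipschitz_near_cutoff
      lipschitz_near_cutoff')

lemma lipschitz_near_cut_stair':
  assumes "0 < b" "b < 1/2" shows "lipschitz_near (cut_stair' b d) p"
  unfolding cut_stair'_def[abs_def] divide_inverse
  by (intro lipschitz_near_add lipschitz_near_mult lipschitz_near_const lipschitz_near_cutoff
      lipschitz_near_cutoff' lipschitz_near_id
      lipschitz_near_compose[where g = "staircase b", OF _ lipschitz_near_staircase[OF assms]]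
      lipschitz_near_compose[where g = "staircase' b", OF _ lipschitz_near_staircase'[OF assms]])

lemma lipschitz_near_cut_id: "lipschitz_near cut_id p"
  using has_real_derivative_cut_id lipschitz_near_cut_id' by (rule lipschitz_near_C1_UNIV)

lemma lipschitz_near_cut_stair:
  assumes "0 < b" "b < 1/2" "d > 0" shows "lipschitz_near (cut_stair b d) p"
  using has_real_derivative_cut_stair[OF assms] lipschitz_near_cut_stair'[OF assms(1,2)]
  by (rule lipschitz_near_C1_UNIV)

text \<open>The derivative in \<open>y\<close> of the stream function
  \<open>cut_id y * cut_stair b d x - cut_id x * cut_stair b d y\<close>. This function is
  antisymmetric, so minus its derivative in \<open>x\<close> is \<open>profile b d y x\<close>.
  Cutting off the factors of the stream function, not the velocity, keeps the field divergence
  free.\<close>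

definition profile :: "real \<Rightarrow> real \<Rightarrow> real \<Rightarrow> real \<Rightarrow> real" where
  "profile b d x y = cut_stair b d x * cut_id' y - cut_id x * cut_stair' b d y"

lemma profile_outer:
  assumes "\<bar>x\<bar> \<ge> 2 \<or> \<bar>y\<bar> \<ge> 2" shows "profile b d x y = 0"
  using assms by (auto simp: profile_def cut_stair_def cut_id_def cut_id'_def cut_stair'_def cutoff_outer)

text \<open>The bound does not involve \<open>d\<close>, so it serves all stages at once. Where the
  cutoffs are nonzero, \<open>d * staircase b (z / d)\<close> differs from \<open>z\<close> by at
  most \<open>4 * d\<close>, and in its derivative the factor \<open>d\<close> cancels the inner
  \<open>1 / d\<close>.\<close>

lemma abs_profile_le:
  assumes "0 < b" "b < 1/2" "0 < d" "d \<le> 1"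
  shows "\<bar>profile b d x y\<bar> \<le> 9 * (27/2) + 3 * (36 + 9 / (4 * b))"
proof (cases "\<bar>x\<bar> \<ge> 2 \<or> \<bar>y\<bar> \<ge> 2")
  case True
  have "0 \<le> 9 / (4 * b)" using assms by simp
  then show ?thesis using profile_outer[OF True] by simp
next
  case False
  have st: "\<bar>d * staircase b (z / d)\<bar> \<le> 6" if "\<bar>z\<bar> < 2" for z
  proof -
    have "\<bar>d * staircase b (z / d) - z\<bar> = d * \<bar>staircase b (z / d) - z / d\<bar>"
      using assms abs_mult[of d "staircase b (z / d) - z / d"] by (simp add: right_diff_distrib)
    also have "\<dots> \<le> 1 * 4" using assms abs_staircase_diff_le[OF assms(1), of "z/d"] by (intro mult_mono) auto
    finally show ?thesis using that by linarith
  qed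
  have 1: "\<bar>cut_stair b d x\<bar> \<le> (3/2) * 6"
    unfolding cut_stair_def abs_mult using st[of x] False abs_cutoff_le[of x]
    by (intro mult_mono) (auto simp: abs_mult)
  have 2: "\<bar>cut_id x\<bar> \<le> 2 * (3/2)"
    unfolding cut_id_def abs_mult using False abs_cutoff_le[of x] by (intro mult_mono) auto
  have "\<bar>y * cutoff' y\<bar> \<le> 2 * 6"
    unfolding abs_mult using False abs_cutoff'_le[of y] by (intro mult_mono) auto
  then have 3: "\<bar>cut_id' y\<bar> \<le> 27/2" unfolding cut_id'_def using abs_cutoff_le[of y] by linarith
  have "\<bar>cutoff' y * (d * staircase b (y / d))\<bar> \<le> 6 * 6"
    unfolding abs_mult[of "cutoff' y"] using st[of y] False abs_cutoff'_le[of y] by (intro mult_mono) auto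
  moreover have "\<bar>cutoff y * staircase' b (y / d)\<bar> \<le> (3/2) * (3 / (2 * b))"
    unfolding abs_mult using abs_cutoff_le[of y] abs_staircase'_le[OF assms(1), of "y/d"]
    by (intro mult_mono) auto
  ultimately have 4: "\<bar>cut_stair' b d y\<bar> \<le> 36 + 9 / (4 * b)"
    unfolding cut_stair'_def by (simp add: field_simps)
  have "\<bar>profile b d x y\<bar> \<le> \<bar>cut_stair b d x\<bar> * \<bar>cut_id' y\<bar> + \<bar>cut_id x\<bar> * \<bar>cut_stair' b d y\<bar>"
    unfolding profile_def by (metis abs_mult abs_triangle_ineq4)
  also have "\<dots> \<le> 9 * (27/2) + 3 * (36 + 9 / (4 * b))"
    using 1 2 3 4 by (intro add_mono mult_mono) auto
  finally show ?thesis .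
qed

lemma profile_plateau:
  assumes b: "0 < b" "b < 1/2" and d: "d > 0"
    and x: "\<bar>x - d * (real_of_int i + 1/2)\<bar> \<le> d * (1/2 - b)" "\<bar>x\<bar> \<le> 1"
    and y: "\<bar>y - d * (real_of_int j + 1/2)\<bar> \<le> d * (1/2 - b)" "\<bar>y\<bar> \<le> 1"
  shows "profile b d x y = d * (i + 1/2)"
proof -
  have *: "\<bar>z / d - (real_of_int k + 1/2)\<bar> \<le> 1/2 - b"
    if "\<bar>z - d * (real_of_int k + 1/2)\<bar> \<le> d * (1/2 - b)" for z k
  proof -
    have "\<bar>z / d - (real_of_int k + 1/2)\<bar> = \<bar>z - d * (real_of_int k + 1/2)\<bar> / d"
      using d by (simp add: abs_div_pos diff_divide_distrib)
    also have "\<dots> \<le> d * (1/2 - b) / d" using that d by (intro divide_right_mono) auto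
    finally show ?thesis using d by simp
  qed
  show ?thesis
    using staircase_plateau[OF b *[OF x(1)]] staircase_plateau[OF b *[OF y(1)]] x(2) y(2)
    by (simp add: profile_def cut_stair_def cut_id_def cut_id'_def cut_stair'_def cutoff_inner)
qed

section \<open>The contraction factor\<close>

locale cantor_flow =
  fixes r :: real
  assumes r_pos: "0 < r" and r_half: "r < 1/2"
begin

text \<open>One stage corresponds to a unit increase of \<open>1 / t\<close>, so
  \<open>exp (- rate) = 2 * r\<close> is the contraction per stage.\<close>

definition rate :: real where "rate = - ln (2 * r)"

lemma rate_pos: "rate > 0"
  using r_pos r_half by (simp add: rate_def ln_less_zero)

text \<open>The oscillating term makes \<open>scale'\<close> vanish at all times \<open>1 / n\<close>, where the stages are glued together.\<close>

definition scale :: "real \<Rightarrow> real" where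
  "scale t = (if t \<le> 0 then 0 else exp (- rate * (1 / t - sin (2 * pi / t) / (2 * pi))))"

definition scale' :: "real \<Rightarrow> real" where
  "scale' t = (if t \<le> 0 then 0 else rate * scale t * (1 - cos (2 * pi / t)) / t\<^sup>2)"

lemma scale_pos: "t > 0 \<Longrightarrow> scale t > 0"
  by (simp add: scale_def)

lemma scale_nonneg: "scale t \<ge> 0"
  by (simp add: scale_def)

lemma scale'_nonneg: "scale' t \<ge> 0"
  using rate_pos scale_nonneg[of t] by (simp add: scale'_def)

lemma scale_inverse_Suc: "scale (1 / (real k + 1)) = (2 * r) ^ Suc k"
proof -
  have "sin (2 * pi * (real k + 1)) = 0"
    using sin_2npi[of "Suc k"] by (simp add: algebra_simps)
  then have "scale (1 / (real k + 1)) = exp (real (Suc k) * ln (2 * r))"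
    by (simp add: scale_def rate_def mult.commute)
  also have "\<dots> = exp (ln (2 * r)) ^ Suc k" by (rule exp_of_nat_mult)
  finally show ?thesis using r_pos by simp
qed

lemma scale'_inverse_Suc: "scale' (1 / (real k + 1)) = 0"
proof -
  have "cos (2 * pi * (real k + 1)) = 1"
    using cos_2npi[of "Suc k"] by (simp add: algebra_simps)
  then show ?thesis by (simp add: scale'_def)
qed

lemma has_real_derivative_scale:
  assumes "t > 0" shows "(scale has_real_derivative scale' t) (at t)"
proof -
  have d: "((\<lambda>t. exp (- rate * (1 / t - sin (2 * pi / t) / (2 * pi)))) has_real_derivative
     exp (- rate * (1 / t - sin (2 * pi / t) / (2 * pi))) * (rate * (1 - cos (2 * pi / t)) / t\<^sup>2)) (at t)"
    using assms by (auto intro!: derivative_eq_intros simp: field_simps power2_eq_square)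
  have "\<forall>\<^sub>F s in nhds t. s \<in> {0<..}" using assms by (intro eventually_nhds_in_open) auto
  then have "\<forall>\<^sub>F s in nhds t. exp (- rate * (1 / s - sin (2 * pi / s) / (2 * pi))) = scale s"
    by eventually_elim (simp add: scale_def)
  moreover have "exp (- rate * (1 / t - sin (2 * pi / t) / (2 * pi))) * (rate * (1 - cos (2 * pi / t)) / t\<^sup>2) = scale' t"
    using assms by (simp add: scale_def scale'_def)
  ultimately show ?thesis by (rule DERIV_cong_ev[OF refl, THEN iffD1, OF _ _ d])
qed

lemma scale_mono:
  assumes "s \<le> t" shows "scale s \<le> scale t"
proof (cases "s \<le> 0")
  case True then show ?thesis using scale_nonneg[of t] by (simp add: scale_def)
next
  case False
  show ?thesis
  proof (rule DERIV_nonneg_imp_nondecreasing[OF assms])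
    fix x assume "s \<le> x" "x \<le> t"
    then show "\<exists>y. (scale has_real_derivative y) (at x) \<and> 0 \<le> y"
      using False has_real_derivative_scale[of x] scale'_nonneg[of x] by auto
  qed
qed

lemma isCont_scale: "t > 0 \<Longrightarrow> isCont scale t"
  using has_real_derivative_scale DERIV_isCont by blast

lemma lipschitz_near_inverse:
  fixes p :: real assumes "p > 0" shows "lipschitz_near inverse p"
proof (rule lipschitz_near_C1[of "{0<..}"])
  show "(inverse has_real_derivative - (inverse x ^ Suc (Suc 0))) (at x)" if "x \<in> {0<..}" for x :: real
    using that by (intro DERIV_inverse) auto
qed (use assms in \<open>auto intro!: continuous_intros\<close>)

lemma lipschitz_near_scale:
  assumes "t > 0" shows "lipschitz_near scale t"
proof (rule lipschitz_near_C1[of "{0<..}"])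
  have "continuous_on {0<..} (\<lambda>t. rate * scale t * (1 - cos (2 * pi / t)) / t\<^sup>2)"
    by (intro continuous_intros continuous_at_imp_continuous_on ballI isCont_scale) auto
  then show "continuous_on {0<..} scale'"
    by (rule continuous_on_eq) (simp add: scale'_def)
qed (use assms has_real_derivative_scale in auto)

lemma lipschitz_near_scale':
  assumes "t > 0" shows "lipschitz_near scale' t"
proof -
  have 1: "lipschitz_near cos x" for x :: real
    by (rule lipschitz_near_C1[of UNIV _ _ "\<lambda>x. - sin x"]) (auto intro!: DERIV_cos continuous_intros)
  have "lipschitz_near (\<lambda>t. rate * scale t * (1 - cos (2 * pi * inverse t)) * (inverse t * inverse t)) t"
    by (intro lipschitz_near_mult lipschitz_near_diff lipschitz_near_const lipschitz_near_scale
        lipschitz_near_compose[where g = cos, OF _ 1] lipschitz_near_inverse assms)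
  moreover have "\<forall>\<^sub>F s in nhds t. s \<in> {0<..}" using assms by (intro eventually_nhds_in_open) auto
  then have "\<forall>\<^sub>F s in nhds t. rate * scale s * (1 - cos (2 * pi * inverse s)) * (inverse s * inverse s) = scale' s"
    by eventually_elim (simp add: scale'_def divide_inverse power2_eq_square)
  ultimately show ?thesis by (rule lipschitz_near_cong)
qed

lemma exp_ge_cube:
  fixes x :: real assumes "x \<ge> 0" shows "x ^ 3 / 27 \<le> exp x"
proof -
  have "x / 3 \<le> exp (x / 3)" using exp_ge_add_one_self[of "x/3"] by linarith
  then have "(x / 3) ^ 3 \<le> exp (x / 3) ^ 3" using assms by (intro power_mono) auto
  also have "\<dots> = exp x" by (simp flip: exp_of_nat_mult)
  finally show ?thesis by (simp add: power_divide)
qed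

text \<open>Comes from bounding the sine by 1 and \<open>exp (rate / t)\<close> from below by a
  cube. The third power is chosen because \<open>scale'\<close> divides by \<open>t^2\<close>: one
  factor \<open>t\<close> survives and makes the speed vanish at time 0.\<close>

definition growth :: real where "growth = 27 * exp (rate / (2 * pi)) / rate ^ 3"

lemma growth_pos: "growth > 0"
  using rate_pos by (simp add: growth_def)

lemma scale_le_cube:
  assumes "t \<ge> 0" shows "scale t \<le> growth * t ^ 3"
proof (cases "t = 0")
  case False
  then have t: "t > 0" using assms by simp
  have e: "(rate / t) ^ 3 / 27 \<le> exp (rate / t)" using rate_pos t by (intro exp_ge_cube) auto
  have "rate * sin (2 * pi / t) \<le> rate * 1" using rate_pos by (intro mult_left_mono) auto
  then have "scale t \<le> exp (rate / (2 * pi) - rate / t)"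
    using t by (simp add: scale_def right_diff_distrib divide_right_mono)
  also have "\<dots> = exp (rate / (2 * pi)) / exp (rate / t)" by (rule exp_diff)
  also have "\<dots> \<le> exp (rate / (2 * pi)) / ((rate / t) ^ 3 / 27)"
    using e rate_pos t by (intro divide_left_mono) auto
  also have "\<dots> = growth * t ^ 3" using t rate_pos by (simp add: growth_def power_divide)
  finally show ?thesis .
qed (simp add: scale_def)

lemma scale'_le:
  assumes "t \<ge> 0" shows "scale' t \<le> 2 * rate * growth * t"
proof (cases "t = 0")
  case False
  then have t: "t > 0" using assms by simp
  have "scale t * (1 - cos (2 * pi / t)) \<le> (growth * t ^ 3) * 2"
    using scale_le_cube[of t] cos_ge_minus_one[of "2 * pi / t"] scale_nonneg[of t] t growth_pos
    by (intro mult_mono) auto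
  then have "rate * (scale t * (1 - cos (2 * pi / t))) / t\<^sup>2 \<le> rate * ((growth * t ^ 3) * 2) / t\<^sup>2"
    using rate_pos by (intro divide_right_mono mult_left_mono) auto
  also have "\<dots> = 2 * rate * growth * t" using t by (simp add: power2_eq_square power3_eq_cube)
  finally show ?thesis using t by (simp add: scale'_def mult.assoc)
qed (simp add: scale'_def)

end

section \<open>The velocity field\<close>

text \<open>Two points at distance less than 1 either both lie in the unit enlargement
  \<open>K'\<close> of \<open>K\<close>, which is still compact, or both lie outside
  \<open>K\<close>, where \<open>f\<close> vanishes.\<close>

lemma uniformly_continuous_on_compact_support:
  fixes f :: "'a::euclidean_space \<Rightarrow> 'b::real_normed_vector"
  assumes f: "continuous_on UNIV f" and K: "compact K" "\<And>x. x \<notin> K \<Longrightarrow> f x = 0"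
  shows "uniformly_continuous_on UNIV f"
proof -
  define K' where "K' = {x + y | x y. x \<in> K \<and> y \<in> cball 0 1}"
  have "compact K'" unfolding K'_def by (intro compact_sums K) simp
  then have uc: "uniformly_continuous_on K' f"
    by (intro compact_uniformly_continuous continuous_on_subset[OF f]) auto
  have near: "y \<in> K'" if "x \<in> K" "dist y x < 1" for x y
  proof -
    have "y = x + (y - x)" "y - x \<in> cball 0 1" using that by (auto simp: dist_norm norm_minus_commute)
    then show ?thesis unfolding K'_def using that(1) by blast
  qed
  show ?thesis unfolding uniformly_continuous_on_def
  proof (intro allI impI)
    fix e :: real assume e: "e > 0"
    then obtain d where d: "d > 0" "\<And>x x'. x \<in> K' \<Longrightarrow> x' \<in> K' \<Longrightarrow> dist x' x < d \<Longrightarrow> dist (f x') (f x) < e"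
      using uc unfolding uniformly_continuous_on_def by metis
    have "dist (f x') (f x) < e" if "dist x' x < min d 1" for x x'
    proof (cases "x \<in> K \<or> x' \<in> K")
      case True
      then have "x \<in> K'" "x' \<in> K'" using near[of x x] near[of x x'] near[of x' x] near[of x' x'] that
        by (auto simp: dist_commute)
      then show ?thesis using d(2) that by auto
    qed (use K(2) e in auto)
    then show "\<exists>d>0. \<forall>x\<in>UNIV. \<forall>x'\<in>UNIV. dist x' x < d \<longrightarrow> dist (f x') (f x) < e"
      using d(1) by (intro exI[of _ "min d 1"]) auto
  qed
qed

lemma vector2_eq: "(vector [a, b] :: real^2) = a *\<^sub>R axis 1 1 + b *\<^sub>R axis 2 1"
  by (simp add: vec_eq_iff forall_2 axis_def)

lemma norm_vector2_le: "norm (vector [a, b] :: real^2) \<le> \<bar>a\<bar> + \<bar>b\<bar>"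
  using norm_le_l1_cart[of "vector [a, b] :: real^2"] by (simp add: sum_2)

lemma lipschitz_near_vector2:
  assumes "lipschitz_near f p" "lipschitz_near g p"
  shows "lipschitz_near (\<lambda>x. vector [f x, g x] :: real^2) p"
proof -
  have *: "lipschitz_near (\<lambda>s. s *\<^sub>R (v :: real^2)) s" for s v
    by (intro lipschitz_near_bounded_linear bounded_linear_scaleR_left)
  show ?thesis unfolding vector2_eq
    by (intro lipschitz_near_add lipschitz_near_compose[OF assms(1) *] lipschitz_near_compose[OF assms(2) *])
qed

context cantor_flow
begin

text \<open>After rescaling the cells to unit length, a Cantor square occupies the middle part of length
  \<open>1 - 2 * slack\<close> of its cell.\<close>

definition slack :: real where "slack = (1 - 2 * r) / (4 * (1 - r))"

lemma slack_bounds: "0 < slack" "slack < 1/2"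
  using r_pos r_half by (auto simp: slack_def field_simps)

text \<open>The lower end is positive, so \<open>mode\<close> divides by a positive scale at every
  real time.\<close>

definition clip :: "nat \<Rightarrow> real \<Rightarrow> real" where
  "clip n t = max (1 / (real n + 2)) (min (1 / (real n + 1)) t)"

text \<open>Since \<open>scale'\<close> vanishes at the ends of the \<open>n\<close>-th stage, clipping the time switches the field off
  outside the stage without destroying its Lipschitz continuity.\<close>

definition mode :: "nat \<Rightarrow> real \<Rightarrow> real^2 \<Rightarrow> real^2" where
  "mode n t x = (let s = scale (clip n t); v = scale' (clip n t) in
     vector [v * profile slack (1 / 2^n) (x $ 1 / s) (x $ 2 / s),
             v * profile slack (1 / 2^n) (x $ 2 / s) (x $ 1 / s)])"

text \<open>At every time at most one summand is nonzero. A sum, in place of a case distinction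
  between stages, lets the Lipschitz property at the junctions \<open>1 / (n + 1)\<close> follow
  from that of finite sums.\<close>

definition velocity :: "real \<Rightarrow> real^2 \<Rightarrow> real^2" where
  "velocity t x = (\<Sum>n. mode n t x)"

lemma clip_bounds: "1 / (real n + 2) \<le> clip n t" "clip n t \<le> 1 / (real n + 1)"
  by (auto simp: clip_def frac_le)

lemma clip_pos: "clip n t > 0"
  using clip_bounds(1)[of n t] by (smt (verit) divide_pos_pos of_nat_0_le_iff)

lemma mode_zero:
  assumes "t \<le> 1 / (real n + 2) \<or> 1 / (real n + 1) \<le> t"
  shows "mode n t x = 0"
proof -
  have "1 / (real n + 2) \<le> 1 / (real n + 1)" by (simp add: frac_le)
  then have "clip n t = 1 / (real n + 2) \<or> clip n t = 1 / (real n + 1)"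
    using assms unfolding clip_def by linarith
  moreover have "scale' (1 / (real n + 2)) = 0" using scale'_inverse_Suc[of "Suc n"]
    by (simp add: add.commute)
  ultimately have "scale' (clip n t) = 0" using scale'_inverse_Suc[of n] by auto
  then show ?thesis by (simp add: mode_def Let_def vector2_eq)
qed

lemma velocity_eq_sum:
  assumes "1 / (real N + 2) \<le> t"
  shows "velocity t x = (\<Sum>n\<le>N. mode n t x)"
  unfolding velocity_def
proof (rule suminf_finite)
  fix n assume "n \<notin> {..N}"
  then have "1 / (real n + 1) \<le> 1 / (real N + 2)" by (intro divide_left_mono) auto
  then show "mode n t x = 0" using assms by (intro mode_zero) auto
qed simp

lemma velocity_eq_mode:
  assumes "1 / (real n + 2) \<le> t" "t \<le> 1 / (real n + 1)"
  shows "velocity t x = mode n t x"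
proof -
  have "mode k t x = 0" if "k < n" for k
  proof -
    have "1 / (real n + 1) \<le> 1 / (real k + 2)" using that by (intro divide_left_mono) auto
    then show ?thesis using assms by (intro mode_zero) auto
  qed
  then have "(\<Sum>k\<le>n. mode k t x) = mode n t x"
    by (simp add: lessThan_Suc_atMost[symmetric])
  then show ?thesis using velocity_eq_sum[OF assms(1)] by simp
qed

lemma velocity_zero:
  assumes "t \<le> 0 \<or> t \<ge> 1" shows "velocity t x = 0"
proof -
  have "mode n t x = 0" for n
  proof (rule mode_zero)
    have "0 \<le> 1 / (real n + 2)" "1 / (real n + 1) \<le> 1" by auto
    then show "t \<le> 1 / (real n + 2) \<or> 1 / (real n + 1) \<le> t" using assms by linarith
  qed
  then show ?thesis by (simp add: velocity_def)
qed

lemma stage_exists: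
  assumes "0 < t" "t \<le> 1"
  obtains n where "1 / (real n + 2) < t" "t \<le> 1 / (real n + 1)"
proof -
  \<comment> \<open>The time lies above \<open>1 / (k + 1)\<close> and not above
    \<open>1 / k\<close>, which is the stage numbered \<open>k - 1\<close>. The strict lower
    inequality is what the two-sided derivative in \<open>has_real_derivative_coord\<close>
    needs.\<close>
  define k where "k = nat \<lfloor>1 / t\<rfloor>"
  have "1 \<le> 1 / t" using assms by simp
  then have k: "real k \<le> 1 / t" "1 / t < real k + 1" "k \<ge> 1"
    unfolding k_def by linarith+
  show thesis
  proof (rule that[of "k - 1"])
    have r: "real (k - 1) = real k - 1" using k by simp
    show "1 / (real (k - 1) + 2) < t" unfolding r using k assms by (simp add: field_simps)
    show "t \<le> 1 / (real (k - 1) + 1)" unfolding r using k assms by (simp add: field_simps)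
  qed
qed

lemma clip_eq: "1 / (real n + 2) \<le> t \<Longrightarrow> t \<le> 1 / (real n + 1) \<Longrightarrow> clip n t = t"
  by (simp add: clip_def)

lemma velocity_outer:
  assumes "2 * scale t \<le> \<bar>x $ i\<bar>" shows "velocity t x = 0"
proof (cases "t \<le> 0 \<or> t \<ge> 1")
  case False
  then obtain n where "1 / (real n + 2) < t" "t \<le> 1 / (real n + 1)"
    using stage_exists[of t] by auto
  then have n: "1 / (real n + 2) \<le> t" "t \<le> 1 / (real n + 1)" by auto
  have "\<bar>x $ i / scale t\<bar> \<ge> 2" using assms False scale_pos[of t] by (simp add: field_simps)
  moreover have "i = 1 \<or> i = 2" by (rule exhaust_2)
  ultimately have "\<bar>x $ 1 / scale t\<bar> \<ge> 2 \<or> \<bar>x $ 2 / scale t\<bar> \<ge> 2" by auto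
  then show ?thesis unfolding velocity_eq_mode[OF n] mode_def clip_eq[OF n] Let_def
    by (auto simp: profile_outer vector2_eq)
qed (simp add: velocity_zero)

definition bound :: real where
  "bound = 2 * (2 * rate * growth) * (9 * (27/2) + 3 * (36 + 9 / (4 * slack)))"

lemma norm_velocity_le:
  assumes "t \<ge> 0" shows "norm (velocity t x) \<le> bound * t"
proof (cases "t \<le> 0 \<or> t \<ge> 1")
  case True
  have "0 \<le> bound" using rate_pos growth_pos slack_bounds by (simp add: bound_def)
  then show ?thesis using assms velocity_zero[OF True] by simp
next
  case False
  then obtain n where "1 / (real n + 2) < t" "t \<le> 1 / (real n + 1)"
    using stage_exists[of t] by auto
  then have n: "1 / (real n + 2) \<le> t" "t \<le> 1 / (real n + 1)" by auto
  define B where "B = 9 * (27/2) + 3 * (36 + 9 / (4 * slack))"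
  have *: "\<bar>scale' t * profile slack (1 / 2^n) a b\<bar> \<le> (2 * rate * growth * t) * B" for a b
    unfolding abs_mult B_def using scale'_le[OF assms] scale'_nonneg[of t] assms rate_pos growth_pos
    by (intro mult_mono abs_profile_le slack_bounds) auto
  have "norm (velocity t x) \<le> (2 * rate * growth * t) * B + (2 * rate * growth * t) * B"
    unfolding velocity_eq_mode[OF n] mode_def clip_eq[OF n] Let_def
    by (intro order_trans[OF norm_vector2_le] add_mono *)
  also have "\<dots> = bound * t" by (simp add: bound_def B_def algebra_simps)
  finally show ?thesis .
qed

lemma lipschitz_near_clip: "lipschitz_near (clip n) t"
  unfolding clip_def[abs_def] by (rule lipschitz_near_max_min)

lemma lipschitz_near_profile:
  assumes "lipschitz_near f p" "lipschitz_near g p"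
  shows "lipschitz_near (\<lambda>x. profile slack (1 / 2^n) (f x) (g x)) p"
  unfolding profile_def
  by (intro lipschitz_near_diff lipschitz_near_mult
      lipschitz_near_compose[OF assms(1) lipschitz_near_cut_stair[OF slack_bounds]]
      lipschitz_near_compose[OF assms(2) lipschitz_near_cut_stair'[OF slack_bounds]]
      lipschitz_near_compose[OF assms(1) lipschitz_near_cut_id]
      lipschitz_near_compose[OF assms(2) lipschitz_near_cut_id']) simp

lemma lipschitz_near_mode: "lipschitz_near (\<lambda>(t, x). mode n t x) p"
proof -
  have c: "lipschitz_near (\<lambda>p :: real \<times> (real^2). clip n (fst p)) p"
    by (intro lipschitz_near_compose[OF _ lipschitz_near_clip] lipschitz_near_bounded_linear
        bounded_linear_fst)
  have s: "lipschitz_near (\<lambda>p :: real \<times> (real^2). scale (clip n (fst p))) p"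
    by (intro lipschitz_near_compose[OF c lipschitz_near_scale] clip_pos)
  have v: "lipschitz_near (\<lambda>p :: real \<times> (real^2). scale' (clip n (fst p))) p"
    by (intro lipschitz_near_compose[OF c lipschitz_near_scale'] clip_pos)
  have x: "lipschitz_near (\<lambda>p :: real \<times> (real^2). snd p $ i / scale (clip n (fst p))) p" for i
    unfolding divide_inverse
    by (intro lipschitz_near_mult lipschitz_near_compose[OF s lipschitz_near_inverse] scale_pos clip_pos
        lipschitz_near_bounded_linear bounded_linear_compose[OF bounded_linear_vec_nth bounded_linear_snd])
  show ?thesis unfolding mode_def Let_def case_prod_beta
    by (intro lipschitz_near_vector2 lipschitz_near_mult v lipschitz_near_profile x)
qed

text \<open>Near a positive time only finitely many modes are active. At time 0 away from the origin
  the field vanishes nearby, because it lives where both coordinates are below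
  \<open>2 * scale t\<close>. Negative times are included so that full balls can be used.\<close>

lemma lipschitz_near_velocity:
  assumes "fst p > 0 \<or> (fst p = 0 \<and> snd p \<noteq> 0) \<or> fst p < 0"
  shows "lipschitz_near (\<lambda>(t, x). velocity t x) p"
proof -
  consider "fst p > 0" | "fst p = 0" "snd p \<noteq> 0" | "fst p < 0" using assms by blast
  then show ?thesis
  proof cases
    case 1
    then obtain N where N: "inverse (real (Suc N)) < fst p" using reals_Archimedean by blast
    have N': "1 / (real N + 2) < fst p"
      by (rule le_less_trans[OF _ N]) (simp add: field_simps)
    have "\<forall>\<^sub>F q in nhds p. q \<in> {1 / (real N + 2) <..} \<times> UNIV"
      using N' by (intro eventually_nhds_in_open open_Times) (auto simp: mem_Times_iff)
    then have "\<forall>\<^sub>F q in nhds p. (\<Sum>n\<le>N. case q of (t, x) \<Rightarrow> mode n t x) = (case q of (t, x) \<Rightarrow> velocity t x)"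
      by eventually_elim (auto simp: velocity_eq_sum[OF less_imp_le])
    then show ?thesis
      by (rule lipschitz_near_cong[OF lipschitz_near_sum[OF lipschitz_near_mode]])
  next
    case 2
    then obtain i where i: "snd p $ i \<noteq> 0" by (auto simp: vec_eq_iff)
    define a where "a = \<bar>snd p $ i\<bar>"
    \<comment> \<open>This choice gives
      \<open>2 * scale t <= 2 * growth * t <= a / 2 < \<bar>x $ i\<bar>\<close> for
      \<open>0 < t < d\<close>; the 1 ensures \<open>t ^ 3 <= t\<close>.\<close>
    define d where "d = min 1 (a / (4 * growth))"
    have d: "d > 0" using i growth_pos by (simp add: a_def d_def)
    have "open {q :: real \<times> (real^2). fst q < d \<and> \<bar>snd q $ i\<bar> > a / 2}"
      by (intro open_Collect_conj open_Collect_less continuous_intros)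
    then have "\<forall>\<^sub>F q in nhds p. q \<in> {q. fst q < d \<and> \<bar>snd q $ i\<bar> > a / 2}"
      using 2 d i by (intro eventually_nhds_in_open) (auto simp: a_def)
    then have "\<forall>\<^sub>F q in nhds p. 0 = (case q of (t, x) \<Rightarrow> velocity t x)"
    proof eventually_elim
      case (elim q)
      obtain t x where q: "q = (t, x)" by (cases q)
      show ?case
      proof (cases "t \<le> 0")
        case False
        then have t: "0 < t" "t < d" "t \<le> 1" using elim q by (auto simp: d_def)
        have "t ^ 3 \<le> t" using t power_decreasing[of 1 3 t] by simp
        then have "scale t \<le> growth * t" using scale_le_cube[of t] t growth_pos
          by (smt (verit) mult_left_mono)
        also have "\<dots> \<le> growth * (a / (4 * growth))" using t growth_pos by (intro mult_left_mono) (auto simp: d_def)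
        also have "\<dots> = a / 4" using growth_pos by simp
        finally have "2 * scale t \<le> \<bar>x $ i\<bar>" using elim q by simp
        then show ?thesis using q by (simp add: velocity_outer)
      qed (simp add: q velocity_zero)
    qed
    then show ?thesis by (rule lipschitz_near_cong[OF lipschitz_near_const])
  next
    case 3
    then have "\<forall>\<^sub>F q in nhds p. q \<in> {..<0} \<times> UNIV"
      by (intro eventually_nhds_in_open open_Times) (auto simp: mem_Times_iff)
    then have "\<forall>\<^sub>F q in nhds p. 0 = (case q of (t, x) \<Rightarrow> velocity t x)"
      by eventually_elim (auto simp: velocity_zero)
    then show ?thesis by (rule lipschitz_near_cong[OF lipschitz_near_const])
  qed
qed

text \<open>Only the origin needs an argument of its own: there the bound that is linear in the time
  replaces the Lipschitz property.\<close>

lemma continuous_on_velocity: "continuous_on UNIV (\<lambda>(t, x). velocity t x)"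
  unfolding continuous_on_eq_continuous_at[OF open_UNIV]
proof
  fix p :: "real \<times> (real^2)"
  show "isCont (\<lambda>(t, x). velocity t x) p"
  proof (cases "p = 0")
    case True
    have b: "norm (case q of (t, x) \<Rightarrow> velocity t x) \<le> norm (fst q) * bound" for q
    proof (cases "fst q \<ge> 0")
      case True
      then show ?thesis using norm_velocity_le[of "fst q" "snd q"] by (simp add: case_prod_beta mult.commute)
    next
      case False
      have "0 \<le> bound" using rate_pos growth_pos slack_bounds by (simp add: bound_def)
      then show ?thesis using False by (simp add: case_prod_beta velocity_zero mult_nonpos_nonneg)
    qed
    have f: "(fst \<longlongrightarrow> (0::real)) (at (0 :: real \<times> (real^2)))"
      using tendsto_fst[OF tendsto_ident_at, of "0 :: real \<times> (real^2)" UNIV] by simp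
    have "((\<lambda>(t, x). velocity t x) \<longlongrightarrow> 0) (at 0)"
      by (rule tendsto_0_le[where K = bound, OF f]) (intro always_eventually allI b)
    then show ?thesis using True by (simp add: isCont_def velocity_zero case_prod_beta)
  next
    case False
    then have "fst p > 0 \<or> (fst p = 0 \<and> snd p \<noteq> 0) \<or> fst p < 0" by (auto simp: prod_eq_iff)
    then show ?thesis by (intro lipschitz_near_imp_isCont lipschitz_near_velocity)
  qed
qed

definition velocity_box :: "(real \<times> (real^2)) set" where
  "velocity_box = {0..1} \<times> cball 0 4"

lemma compact_velocity_box: "compact velocity_box"
  unfolding velocity_box_def by (intro compact_Times) auto

lemma scale_le_1: "t \<le> 1 \<Longrightarrow> scale t \<le> 1"
  using scale_mono[of t 1] scale_inverse_Suc[of 0] r_half by simp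

lemma velocity_outside_box:
  assumes "(t, x) \<notin> velocity_box" shows "velocity t x = 0"
proof (cases "t \<le> 0 \<or> t \<ge> 1")
  case False
  then have "norm x > 4" using assms by (auto simp: velocity_box_def)
  then have "\<bar>x $ 1\<bar> + \<bar>x $ 2\<bar> > 4" using norm_le_l1_cart[of x] by (simp add: sum_2)
  then have "\<bar>x $ 1\<bar> \<ge> 2 \<or> \<bar>x $ 2\<bar> \<ge> 2" by linarith
  then show ?thesis using scale_le_1[of t] False velocity_outer[of t x 1] velocity_outer[of t x 2] by auto
qed (simp add: velocity_zero)

lemma uniformly_continuous_on_velocity: "uniformly_continuous_on UNIV (\<lambda>(t, x). velocity t x)"
  by (rule uniformly_continuous_on_compact_support[OF continuous_on_velocity compact_velocity_box])
    (auto simp: velocity_outside_box)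

lemma locally_lipschitz_on_velocity:
  "locally_lipschitz_on (({0..} \<times> UNIV) - {(0, 0)}) (\<lambda>(t, x). velocity t x)"
  unfolding locally_lipschitz_on_def
proof
  fix p :: "real \<times> (real^2)" assume "p \<in> ({0..} \<times> UNIV) - {(0, 0)}"
  then have "lipschitz_near (\<lambda>(t, x). velocity t x) p"
    by (intro lipschitz_near_velocity) (auto simp: prod_eq_iff mem_Times_iff)
  then obtain d L where "d > 0" "L-lipschitz_on (ball p d) (\<lambda>(t, x). velocity t x)"
    unfolding lipschitz_near_def by blast
  then show "\<exists>d>0. \<exists>L. L-lipschitz_on (ball p d \<inter> (({0..} \<times> UNIV) - {(0, 0)})) (\<lambda>(t, x). velocity t x)"
    by (blast intro: lipschitz_on_subset)
qed

end

section \<open>Test functions and divergence\<close>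

lemma test_funD:
  fixes \<phi> :: "'a::euclidean_space \<Rightarrow> real"
  assumes "test_fun \<phi>"
  shows test_fun_continuous: "continuous_on UNIV \<phi>"
    and test_fun_has_derivative: "(\<phi> has_derivative frechet_derivative \<phi> (at x)) (at x)"
    and test_fun_continuous_partial: "b \<in> Basis \<Longrightarrow> continuous_on UNIV (\<lambda>x. frechet_derivative \<phi> (at x) b)"
    and test_fun_compact_support: "compact (fun_support \<phi>)"
proof -
  have 0: "Ck 0 \<phi>" and 1: "Ck (Suc 0) \<phi>" and s: "compact (fun_support \<phi>)"
    using assms unfolding test_fun_def smooth_fun_def by blast+
  show "continuous_on UNIV \<phi>" using 0 by simp
  have "\<phi> differentiable (at x)" using 1 by simp
  then show "(\<phi> has_derivative frechet_derivative \<phi> (at x)) (at x)" by (simp add: frechet_derivative_works)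
  show "continuous_on UNIV (\<lambda>x. frechet_derivative \<phi> (at x) b)" if "b \<in> Basis" using 1 that by simp
  show "compact (fun_support \<phi>)" by fact
qed

lemma outside_fun_support: "x \<notin> fun_support \<phi> \<Longrightarrow> \<phi> x = 0"
  using subsetD[OF closure_subset, of x "{x. \<phi> x \<noteq> 0}"] by (auto simp: fun_support_def)

lemma frechet_derivative_outside_support:
  assumes "x \<notin> fun_support \<phi>" shows "frechet_derivative \<phi> (at x) v = 0"
proof -
  have "((\<lambda>x. 0) has_derivative (\<lambda>v. 0)) (at x)" by (rule has_derivative_const)
  moreover have "open (- fun_support \<phi>)" by (simp add: fun_support_def open_closed)
  ultimately have "(\<phi> has_derivative (\<lambda>v. 0)) (at x)"
    by (rule has_derivative_transform_within_open) (use assms in \<open>auto simp: outside_fun_support\<close>)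
  then show ?thesis by (metis frechet_derivative_at)
qed

lemma frechet_derivative_test_fun_eq:
  fixes \<phi> :: "'a::euclidean_space \<Rightarrow> real"
  assumes "test_fun \<phi>"
  shows "frechet_derivative \<phi> (at x) v = (\<Sum>b\<in>Basis. (v \<bullet> b) * frechet_derivative \<phi> (at x) b)"
proof -
  have l: "linear (frechet_derivative \<phi> (at x))"
    using test_fun_has_derivative[OF assms] has_derivative_linear by blast
  have "frechet_derivative \<phi> (at x) v = frechet_derivative \<phi> (at x) (\<Sum>b\<in>Basis. (v \<bullet> b) *\<^sub>R b)"
    by (simp add: euclidean_representation)
  also have "\<dots> = (\<Sum>b\<in>Basis. (v \<bullet> b) * frechet_derivative \<phi> (at x) b)"
    by (simp add: linear_sum[OF l] linear_cmul[OF l])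
  finally show ?thesis .
qed

text \<open>\<open>Ck\<close> speaks about derivatives along basis vectors only. Expanding the
  direction in the basis allows it to vary with the point, as the transport term requires.\<close>

lemma continuous_on_frechet_derivative_test_fun:
  fixes \<phi> :: "'a::euclidean_space \<Rightarrow> real"
  assumes \<phi>: "test_fun \<phi>" and f: "continuous_on S f" and g: "continuous_on S g"
  shows "continuous_on S (\<lambda>p. frechet_derivative \<phi> (at (f p)) (g p))"
proof -
  have "continuous_on S (\<lambda>p. \<Sum>b\<in>Basis. (g p \<bullet> b) * frechet_derivative \<phi> (at (f p)) b)"
    by (intro continuous_intros g continuous_on_compose2[OF test_fun_continuous_partial[OF \<phi>] f]) auto
  then show ?thesis by (rule continuous_on_eq) (rule frechet_derivative_test_fun_eq[OF \<phi>, symmetric])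
qed

lemma integrable_continuous_compact_support:
  fixes f :: "'a::euclidean_space \<Rightarrow> real"
  assumes "continuous_on UNIV f" "compact K" "\<And>x. x \<notin> K \<Longrightarrow> f x = 0"
  shows "integrable lborel f"
proof -
  have "integrable lborel (\<lambda>x. indicator K x *\<^sub>R f x)"
    by (intro borel_integrable_compact assms continuous_on_subset[OF assms(1)]) auto
  moreover have "(\<lambda>x. indicator K x *\<^sub>R f x) = f" using assms(3) by (fastforce simp: indicator_def)
  ultimately show ?thesis by simp
qed

text \<open>Translation invariance makes the integral of every difference quotient of \<open>F\<close> vanish.\<close>

lemma integral_directional_derivative:
  fixes F G :: "'a::euclidean_space \<Rightarrow> real"
  assumes F: "continuous_on UNIV F" and G: "continuous_on UNIV G"
    and K: "compact K" "\<And>x. x \<notin> K \<Longrightarrow> F x = 0" "\<And>x. x \<notin> K \<Longrightarrow> G x = 0"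
    and deriv: "\<And>x. ((\<lambda>s. F (x + s *\<^sub>R e)) has_real_derivative G x) (at 0)"
  shows "integrable lborel G" "(\<integral>x. G x \<partial>lborel) = 0"
proof -
  show "integrable lborel G" using integrable_continuous_compact_support[OF G K(1) K(3)] .
  have deriv': "((\<lambda>s. F (x + s *\<^sub>R e)) has_real_derivative G (x + s *\<^sub>R e)) (at s)" for x s
    using DERIV_shift[of "\<lambda>s. F (x + s *\<^sub>R e)" "G (x + s *\<^sub>R e)" 0 s] deriv[of "x + s *\<^sub>R e"]
    by (simp add: algebra_simps)
  obtain B where B: "\<And>x. norm (G x) \<le> B"
  proof -
    have "bounded (G ` K)"
      by (intro compact_imp_bounded compact_continuous_image K continuous_on_subset[OF G]) auto
    then obtain B where "B > 0" "\<And>x. x \<in> K \<Longrightarrow> norm (G x) \<le> B" unfolding bounded_pos by blast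
    then have "norm (G x) \<le> B" for x using K(3)[of x] by (cases "x \<in> K") auto
    then show ?thesis using that by blast
  qed
  have B0: "B \<ge> 0" using norm_ge_zero order_trans B by blast
  \<comment> \<open>Contains \<open>x\<close> whenever some \<open>x + s *\<^sub>R e\<close> with
    \<open>s\<close> between -1 and 1 lies in \<open>K\<close>. Hence one compact set serves to
    dominate all quotients \<open>q n\<close>.\<close>
  define K' where "K' = {k + y | k y. k \<in> K \<and> y \<in> cball 0 (norm e)}"
  have K': "compact K'" unfolding K'_def by (intro compact_sums K) simp
  define q where "q = (\<lambda>n x. (F (x + (1 / real (Suc n)) *\<^sub>R e) - F x) / (1 / real (Suc n)))"
  have int: "integrable lborel (\<lambda>x. F (c + x))" "(\<integral>x. F (c + x) \<partial>lborel) = (\<integral>x. F x \<partial>lborel)" for c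
  proof -
    have i: "integrable lborel F" by (rule integrable_continuous_compact_support[OF F K(1) K(2)])
    have m: "(\<lambda>x. c + x) \<in> lborel \<rightarrow>\<^sub>M borel" "F \<in> borel_measurable borel" using i by auto
    have "integrable (distr lborel borel ((+) c)) F" using i by (simp add: lborel_distr_plus)
    then show "integrable lborel (\<lambda>x. F (c + x))" using integrable_distr_eq[OF m] by simp
    show "(\<integral>x. F (c + x) \<partial>lborel) = (\<integral>x. F x \<partial>lborel)"
      using integral_distr[OF m] by (simp add: lborel_distr_plus)
  qed
  have q0: "(\<integral>x. q n x \<partial>lborel) = 0" for n
  proof -
    have "(\<integral>x. F ((1 / real (Suc n)) *\<^sub>R e + x) - F (0 + x) \<partial>lborel) = 0"
      by (subst Bochner_Integration.integral_diff[OF int(1) int(1)]) (simp add: int(2))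
    then show ?thesis unfolding q_def by (simp add: add.commute)
  qed
  have "(\<lambda>n. \<integral>x. q n x \<partial>lborel) \<longlonglongrightarrow> (\<integral>x. G x \<partial>lborel)"
  proof (rule integral_dominated_convergence[where w = "\<lambda>x. indicator K' x *\<^sub>R B"])
    show "G \<in> borel_measurable lborel" using G by (simp add: borel_measurable_continuous_onI)
    show "q n \<in> borel_measurable lborel" for n
      unfolding q_def using F by (intro borel_measurable_divide borel_measurable_diff)
        (auto intro!: borel_measurable_continuous_onI continuous_intros continuous_on_compose2[OF F])
    show "integrable lborel (\<lambda>x. indicator K' x *\<^sub>R B)"
      by (intro borel_integrable_compact K' continuous_intros)
    show "AE x in lborel. (\<lambda>n. q n x) \<longlonglongrightarrow> G x"
    proof (rule AE_I2)
      fix x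
      have "(\<lambda>h. (F (x + h *\<^sub>R e) - F x) / h) \<midarrow>0\<rightarrow> G x"
        using deriv[of x] by (simp add: DERIV_def)
      moreover have "filterlim (\<lambda>n. 1 / real (Suc n)) (at 0) sequentially"
        unfolding filterlim_at using LIMSEQ_Suc[OF lim_1_over_n] by simp
      ultimately show "(\<lambda>n. q n x) \<longlonglongrightarrow> G x" unfolding q_def by (rule filterlim_compose)
    qed
    show "AE x in lborel. norm (q n x) \<le> indicator K' x *\<^sub>R B" for n
    proof (rule AE_I2)
      fix x
      define h where "h = 1 / real (Suc n)"
      have h: "h > 0" "h \<le> 1" by (auto simp: h_def)
      have near: "x \<in> K'" if "x + s *\<^sub>R e \<in> K" "\<bar>s\<bar> \<le> 1" for s
      proof -
        have "x = (x + s *\<^sub>R e) + (- s *\<^sub>R e)" by simp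
        moreover have "- s *\<^sub>R e \<in> cball 0 (norm e)" using that by (simp add: mult_left_le_one_le)
        ultimately show ?thesis unfolding K'_def using that by blast
      qed
      \<comment> \<open>The mean value theorem turns the quotient into a value of \<open>G\<close>,
        which is bounded by \<open>B\<close> uniformly in \<open>n\<close> and is 0 when
        \<open>x\<close> lies off \<open>K'\<close>.\<close>
      obtain z where z: "0 < z" "z < h" "F (x + h *\<^sub>R e) - F (x + 0 *\<^sub>R e) = (h - 0) * G (x + z *\<^sub>R e)"
        using MVT2[of 0 h "\<lambda>s. F (x + s *\<^sub>R e)" "\<lambda>s. G (x + s *\<^sub>R e)"] h deriv' by blast
      then have q: "q n x = G (x + z *\<^sub>R e)" using h unfolding q_def h_def[symmetric] by simp
      show "norm (q n x) \<le> indicator K' x *\<^sub>R B"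
      proof (cases "x \<in> K'")
        case True then show ?thesis using B q by simp
      next
        case False
        then have "x + z *\<^sub>R e \<notin> K" using near[of z] z h by auto
        then show ?thesis using False q K(3) by simp
      qed
    qed
  qed
  then show "(\<integral>x. G x \<partial>lborel) = 0" using q0 by (simp add: LIMSEQ_const_iff)
qed

text \<open>The integrand is the derivative of \<open>\<psi> x * f x\<close> along the first axis
  plus that of \<open>\<psi> x * g x\<close> along the second, because the two terms with
  \<open>f'\<close> cancel. Each component is differentiated along its own axis only; the cross
  derivatives of \<open>profile\<close> would involve second derivatives of the staircase.\<close>

lemma integral_test_fun_div_free:
  fixes f g f' :: "real^2 \<Rightarrow> real"
  assumes \<psi>: "test_fun \<psi>"
    and cont: "continuous_on UNIV f" "continuous_on UNIV g" "continuous_on UNIV f'"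
    and f: "\<And>x. ((\<lambda>s. f (x + s *\<^sub>R axis 1 1)) has_real_derivative f' x) (at 0)"
    and g: "\<And>x. ((\<lambda>s. g (x + s *\<^sub>R axis 2 1)) has_real_derivative - f' x) (at 0)"
  shows "integrable lborel (\<lambda>x. frechet_derivative \<psi> (at x) (vector [f x, g x]))"
    "(\<integral>x. frechet_derivative \<psi> (at x) (vector [f x, g x]) \<partial>lborel) = 0"
proof -
  define D where "D = (\<lambda>i x. frechet_derivative \<psi> (at x) (axis i 1))"
  define K where "K = fun_support \<psi>"
  have K: "compact K" using test_fun_compact_support[OF \<psi>] by (simp add: K_def)
  have D0: "\<psi> x = 0" "D i x = 0" if "x \<notin> K" for x i
    using that by (auto simp: K_def D_def outside_fun_support frechet_derivative_outside_support)
  have contD: "continuous_on UNIV (D i)" for i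
    unfolding D_def by (intro continuous_on_frechet_derivative_test_fun \<psi> continuous_intros)
  have deriv\<psi>: "((\<lambda>s. \<psi> (x + s *\<^sub>R axis i 1)) has_real_derivative D i x) (at 0)" for x i
  proof -
    have "((\<lambda>s. x + s *\<^sub>R axis i 1) has_derivative (\<lambda>s. s *\<^sub>R axis i 1)) (at 0)"
      by (auto intro!: derivative_eq_intros)
    then have "((\<lambda>s. \<psi> (x + s *\<^sub>R axis i 1)) has_derivative (\<lambda>s. frechet_derivative \<psi> (at x) (s *\<^sub>R axis i 1))) (at 0)"
      by (rule has_derivative_compose) (simp add: test_fun_has_derivative[OF \<psi>])
    moreover have l: "linear (frechet_derivative \<psi> (at x))"
      using test_fun_has_derivative[OF \<psi>] has_derivative_linear by blast
    have "(\<lambda>s. frechet_derivative \<psi> (at x) (s *\<^sub>R axis i 1)) = (*) (D i x)"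
      by (auto simp: D_def linear_cmul[OF l])
    ultimately show ?thesis unfolding has_field_derivative_def by simp
  qed
  note c = cont contD test_fun_continuous[OF \<psi>]
  have I: "integrable lborel (\<lambda>x. D 1 x * f x + f' x * \<psi> x)" "(\<integral>x. D 1 x * f x + f' x * \<psi> x \<partial>lborel) = 0"
  proof -
    have 1: "continuous_on UNIV (\<lambda>x. \<psi> x * f x)" by (intro continuous_intros c)
    have 2: "continuous_on UNIV (\<lambda>x. D 1 x * f x + f' x * \<psi> x)" by (intro continuous_intros c)
    have 3: "((\<lambda>s. \<psi> (x + s *\<^sub>R axis 1 1) * f (x + s *\<^sub>R axis 1 1)) has_real_derivative
        D 1 x * f x + f' x * \<psi> x) (at 0)" for x
      using DERIV_mult[OF deriv\<psi>[where i = 1] f] by simp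
    show "integrable lborel (\<lambda>x. D 1 x * f x + f' x * \<psi> x)" "(\<integral>x. D 1 x * f x + f' x * \<psi> x \<partial>lborel) = 0"
      by (rule integral_directional_derivative[OF 1 2 K _ _ 3]; simp add: D0)+
  qed
  have J: "integrable lborel (\<lambda>x. D 2 x * g x + - f' x * \<psi> x)" "(\<integral>x. D 2 x * g x + - f' x * \<psi> x \<partial>lborel) = 0"
  proof -
    have 1: "continuous_on UNIV (\<lambda>x. \<psi> x * g x)" by (intro continuous_intros c)
    have 2: "continuous_on UNIV (\<lambda>x. D 2 x * g x + - f' x * \<psi> x)" by (intro continuous_intros c)
    have 3: "((\<lambda>s. \<psi> (x + s *\<^sub>R axis 2 1) * g (x + s *\<^sub>R axis 2 1)) has_real_derivative
        D 2 x * g x + - f' x * \<psi> x) (at 0)" for x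
      using DERIV_mult[OF deriv\<psi>[where i = 2] g] by simp
    show "integrable lborel (\<lambda>x. D 2 x * g x + - f' x * \<psi> x)" "(\<integral>x. D 2 x * g x + - f' x * \<psi> x \<partial>lborel) = 0"
      by (rule integral_directional_derivative[OF 1 2 K _ _ 3]; simp add: D0)+
  qed
  have eq: "frechet_derivative \<psi> (at x) (vector [f x, g x]) =
      (D 1 x * f x + f' x * \<psi> x) + (D 2 x * g x + - f' x * \<psi> x)" for x
  proof -
    have l: "linear (frechet_derivative \<psi> (at x))"
      using test_fun_has_derivative[OF \<psi>] has_derivative_linear by blast
    show ?thesis unfolding vector2_eq D_def by (simp add: linear_add[OF l] linear_cmul[OF l])
  qed
  show "integrable lborel (\<lambda>x. frechet_derivative \<psi> (at x) (vector [f x, g x]))"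
    unfolding eq by (rule Bochner_Integration.integrable_add[OF I(1) J(1)])
  show "(\<integral>x. frechet_derivative \<psi> (at x) (vector [f x, g x]) \<partial>lborel) = 0"
    unfolding eq Bochner_Integration.integral_add[OF I(1) J(1)] I(2) J(2) by simp
qed

section \<open>Trajectories\<close>

context cantor_flow
begin

text \<open>Differentiating \<open>profile\<close> in its first argument gives
  \<open>a' x * cut_id' y - cut_id' x * a' y\<close>, which changes sign when the arguments are
  swapped. So the two diagonal derivatives of the field cancel.\<close>

lemma weakly_div_free_velocity: "weakly_div_free velocity"
  unfolding weakly_div_free_def
proof (intro allI impI)
  fix t :: real and \<psi> :: "real^2 \<Rightarrow> real" assume \<psi>: "test_fun \<psi>"
  show "integrable lborel (\<lambda>x. frechet_derivative \<psi> (at x) (velocity t x)) \<and>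
      (\<integral>x. frechet_derivative \<psi> (at x) (velocity t x) \<partial>lborel) = 0"
  proof (cases "t \<le> 0 \<or> t \<ge> 1")
    case True
    have "linear (frechet_derivative \<psi> (at x))" for x
      using test_fun_has_derivative[OF \<psi>] has_derivative_linear by blast
    then have "frechet_derivative \<psi> (at x) 0 = 0" for x by (rule linear_0)
    then show ?thesis by (simp add: velocity_zero[OF True])
  next
    case False
    then obtain n where "1 / (real n + 2) < t" "t \<le> 1 / (real n + 1)"
      using stage_exists[of t] by auto
    then have n: "1 / (real n + 2) \<le> t" "t \<le> 1 / (real n + 1)" by auto
    define s where "s = scale t"
    have s: "s > 0" using False by (simp add: s_def scale_pos)
    define d where "d = (1 / 2 ^ n :: real)"
    have d: "d > 0" by (simp add: d_def)
    define a where "a = cut_stair slack d"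
    define a' where "a' = cut_stair' slack d"
    have a: "(a has_real_derivative a' z) (at z)" "isCont a z" "isCont a' z" for z
      unfolding a_def a'_def
      using has_real_derivative_cut_stair[OF slack_bounds d]
        lipschitz_near_imp_isCont[OF lipschitz_near_cut_stair[OF slack_bounds d]]
        lipschitz_near_imp_isCont[OF lipschitz_near_cut_stair'[OF slack_bounds]] by auto
    have q: "isCont cut_id z" "isCont cut_id' z" for z
      using lipschitz_near_imp_isCont[OF lipschitz_near_cut_id]
        lipschitz_near_imp_isCont[OF lipschitz_near_cut_id'] by auto
    define f where "f = (\<lambda>x::real^2. scale' t * profile slack d (x $ 1 / s) (x $ 2 / s))"
    define g where "g = (\<lambda>x::real^2. scale' t * profile slack d (x $ 2 / s) (x $ 1 / s))"
    define f' where "f' = (\<lambda>x::real^2. scale' t / s * (a' (x $ 1 / s) * cut_id' (x $ 2 / s) -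
        cut_id' (x $ 1 / s) * a' (x $ 2 / s)))"
    have v: "velocity t x = vector [f x, g x]" for x
      unfolding velocity_eq_mode[OF n] mode_def clip_eq[OF n] Let_def f_def g_def s_def d_def ..
    have c: "continuous_on UNIV f" "continuous_on UNIV g" "continuous_on UNIV f'"
      unfolding f_def g_def f'_def profile_def a_def[symmetric] a'_def[symmetric] using s
      by (auto simp: continuous_on_eq_continuous_at
          intro!: continuous_intros isCont_o2[OF _ a(2)] isCont_o2[OF _ a(3)]
            isCont_o2[OF _ q(1)] isCont_o2[OF _ q(2)])
    have p: "((\<lambda>h. profile slack d ((y + h) / s) z) has_real_derivative
        (a' (y / s) * cut_id' z - cut_id' (y / s) * a' z) / s) (at 0)" for y z
    proof -
      have 1: "((\<lambda>h. (y + h) / s) has_real_derivative 1 / s) (at 0)"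
        using s by (auto intro!: derivative_eq_intros)
      have 2: "((\<lambda>h. a ((y + h) / s)) has_real_derivative a' (y / s) * (1 / s)) (at 0)"
        by (rule DERIV_chain2[OF _ 1]) (simp add: a)
      have 3: "((\<lambda>h. cut_id ((y + h) / s)) has_real_derivative cut_id' (y / s) * (1 / s)) (at 0)"
        by (rule DERIV_chain2[OF _ 1]) (simp add: has_real_derivative_cut_id)
      show ?thesis unfolding profile_def a_def[symmetric] a'_def[symmetric]
        using DERIV_diff[OF DERIV_cmult_right[OF 2, of "cut_id' z"] DERIV_cmult_right[OF 3, of "a' z"]]
        by (simp add: diff_divide_distrib)
    qed
    have df: "((\<lambda>h. f (x + h *\<^sub>R axis 1 1)) has_real_derivative f' x) (at 0)" for x
      using DERIV_cmult[OF p[of "x $ 1" "x $ 2 / s"], of "scale' t"]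
      by (simp add: f_def f'_def axis_def)
    have dg: "((\<lambda>h. g (x + h *\<^sub>R axis 2 1)) has_real_derivative - f' x) (at 0)" for x
      using DERIV_cmult[OF p[of "x $ 2" "x $ 1 / s"], of "scale' t"]
      by (simp add: g_def f'_def axis_def algebra_simps diff_divide_distrib)
    show ?thesis unfolding v using integral_test_fun_div_free[OF \<psi> c df dg] by blast
  qed
qed

text \<open>Contribution of the \<open>k\<close>-th sign to a coordinate at time \<open>t\<close>: it is frozen at \<open>r ^ Suc k\<close> after
  time \<open>1 / (k + 1)\<close>.\<close>

definition weight :: "nat \<Rightarrow> real \<Rightarrow> real" where
  "weight k t = scale (min t (1 / (real k + 1))) / 2 ^ Suc k"

definition coord :: "(nat \<Rightarrow> real) \<Rightarrow> real \<Rightarrow> real" where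
  "coord e t = (\<Sum>k. e k * weight k t)"

definition signs :: "(nat \<Rightarrow> real) \<Rightarrow> bool" where
  "signs e \<longleftrightarrow> (\<forall>k. e k = 1 \<or> e k = -1)"

lemma signs_abs: "signs e \<Longrightarrow> \<bar>e k\<bar> = 1"
  unfolding signs_def by (metis abs_1 abs_minus)

lemma weight_nonneg: "weight k t \<ge> 0"
  by (simp add: weight_def scale_nonneg)

lemma weight_late: "1 / (real k + 1) \<le> t \<Longrightarrow> weight k t = r ^ Suc k"
  using scale_inverse_Suc[of k] by (simp add: weight_def power_mult_distrib)

lemma weight_early: "t \<le> 1 / (real k + 1) \<Longrightarrow> weight k t = scale t / 2 ^ Suc k"
  by (simp add: weight_def)

lemma weight_le: "weight k t \<le> r ^ Suc k"
proof -
  have "scale (min t (1 / (real k + 1))) \<le> scale (1 / (real k + 1))" by (rule scale_mono) simp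
  also have "\<dots> = 2 ^ Suc k * r ^ Suc k" unfolding scale_inverse_Suc by (rule power_mult_distrib)
  finally show ?thesis by (simp add: weight_def field_simps)
qed

lemma weight_le_scale: "weight k t \<le> scale t / 2 ^ Suc k"
  by (simp add: weight_def divide_right_mono scale_mono)

lemma summable_r_powers: "summable (\<lambda>k. r ^ (k + n))"
  using r_pos r_half by (simp add: summable_iff_shift summable_geometric)

lemma suminf_r_powers: "(\<Sum>k. r ^ (k + n)) = r ^ n / (1 - r)"
proof -
  have "(\<lambda>k. r ^ n * r ^ k) sums (r ^ n * (1 / (1 - r)))"
    using r_pos r_half by (intro sums_mult geometric_sums) auto
  then show ?thesis by (simp add: sums_iff power_add mult.commute)
qed

lemma summable_coord: assumes "signs e" shows "summable (\<lambda>k. e k * weight k t)"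
proof (rule summable_comparison_test'[OF summable_r_powers[of 1]])
  show "norm (e k * weight k t) \<le> r ^ (k + 1)" for k
    using weight_le[of k t] weight_nonneg[of k t] by (simp add: abs_mult signs_abs[OF assms])
qed

text \<open>One coordinate of the offset of a point from the centre of its square in stage
  \<open>n\<close>: the digits of index above \<open>n\<close> are already frozen, so it does not
  depend on the time.\<close>

definition tail :: "(nat \<Rightarrow> real) \<Rightarrow> nat \<Rightarrow> real" where
  "tail e n = (\<Sum>k. e (k + Suc n) * r ^ (k + Suc (Suc n)))"

lemma abs_tail_le: assumes "signs e" shows "\<bar>tail e n\<bar> \<le> r ^ Suc (Suc n) / (1 - r)"
proof -
  have "norm (tail e n) \<le> (\<Sum>k. r ^ (k + Suc (Suc n)))"
    unfolding tail_def using r_pos signs_abs[OF assms]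
    by (intro norm_suminf_le summable_r_powers) (simp add: abs_mult)
  then show ?thesis by (simp add: suminf_r_powers[of "Suc (Suc n)", simplified])
qed

lemma coord_eq:
  assumes "signs e" "1 / (real n + 2) \<le> t"
  shows "coord e t = (\<Sum>k\<le>n. e k * weight k t) + tail e n"
proof -
  have "coord e t = (\<Sum>k. e (k + Suc n) * weight (k + Suc n) t) + (\<Sum>k<Suc n. e k * weight k t)"
    unfolding coord_def by (rule suminf_split_initial_segment[OF summable_coord[OF assms(1)]])
  moreover have "weight (k + Suc n) t = r ^ (k + Suc (Suc n))" for k
  proof -
    have "1 / (real (k + Suc n) + 1) \<le> 1 / (real n + 2)" by (intro divide_left_mono) auto
    then have "weight (k + Suc n) t = r ^ Suc (k + Suc n)" using assms by (intro weight_late) auto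
    then show ?thesis by simp
  qed
  ultimately show ?thesis by (simp add: tail_def lessThan_Suc_atMost)
qed

definition centre :: "(nat \<Rightarrow> real) \<Rightarrow> nat \<Rightarrow> real" where
  "centre e n = (\<Sum>k\<le>n. e k / 2 ^ Suc k)"

lemma weight_stage:
  assumes "t \<le> 1 / (real n + 1)" "k \<le> n"
  shows "weight k t = scale t / 2 ^ Suc k" "min t (1 / (real k + 1)) = t"
proof -
  have "1 / (real n + 1) \<le> 1 / (real k + 1)" using assms by (intro divide_left_mono) auto
  then have "t \<le> 1 / (real k + 1)" using assms by linarith
  then show "weight k t = scale t / 2 ^ Suc k" "min t (1 / (real k + 1)) = t" by (auto simp: weight_early)
qed

lemma coord_stage:
  assumes "signs e" "1 / (real n + 2) \<le> t" "t \<le> 1 / (real n + 1)"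
  shows "coord e t = scale t * centre e n + tail e n"
  unfolding coord_eq[OF assms(1,2)] centre_def sum_distrib_left
  by (simp add: weight_stage[OF assms(3)] mult.commute)

text \<open>After \<open>1 / (n + 2)\<close> only the weights of index at most \<open>n\<close> can
  still vary. A weight that freezes at \<open>1 / (k + 1)\<close> is differentiable there too,
  because \<open>scale'\<close> vanishes at that time.\<close>

lemma has_real_derivative_coord:
  assumes e: "signs e" and t: "1 / (real n + 2) < t"
  shows "(coord e has_real_derivative (\<Sum>k\<le>n. e k * (scale' (min t (1 / (real k + 1))) / 2 ^ Suc k))) (at t)"
proof -
  have t0: "t > 0" using t by (smt (verit) divide_nonneg_nonneg of_nat_0_le_iff)
  have "(weight k has_real_derivative scale' (min t (1 / (real k + 1))) / 2 ^ Suc k) (at t)" for k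
    unfolding weight_def[abs_def] using t0
    by (intro DERIV_cdivide has_real_derivative_min scale'_inverse_Suc has_real_derivative_scale) auto
  then have "((\<lambda>t. (\<Sum>k\<le>n. e k * weight k t) + tail e n) has_real_derivative
      (\<Sum>k\<le>n. e k * (scale' (min t (1 / (real k + 1))) / 2 ^ Suc k)) + 0) (at t)"
    by (intro DERIV_add DERIV_sum DERIV_cmult DERIV_const)
  moreover have "\<forall>\<^sub>F s in nhds t. s \<in> {1 / (real n + 2)<..}"
    using t by (intro eventually_nhds_in_open) auto
  then have "\<forall>\<^sub>F s in nhds t. (\<Sum>k\<le>n. e k * weight k s) + tail e n = coord e s"
    by eventually_elim (simp add: coord_eq[OF e less_imp_le])
  ultimately show ?thesis using DERIV_cong_ev[OF refl _ refl] by fastforce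
qed

lemma has_real_derivative_coord_stage:
  assumes "signs e" "1 / (real n + 2) < t" "t \<le> 1 / (real n + 1)"
  shows "(coord e has_real_derivative scale' t * centre e n) (at t)"
  using has_real_derivative_coord[OF assms(1,2)] weight_stage(2)[OF assms(3)]
  by (simp add: centre_def sum_distrib_left mult_ac)

lemma has_real_derivative_coord_late:
  assumes "signs e" "t \<ge> 1"
  shows "(coord e has_real_derivative 0) (at t)"
  using has_real_derivative_coord[OF assms(1), of 0 t] assms(2) scale'_inverse_Suc[of 0]
  by (simp add: min_def split: if_splits)

lemma abs_coord_le: assumes "signs e" shows "\<bar>coord e t\<bar> \<le> scale t"
proof -
  have s: "(\<lambda>k. scale t * (1/2) ^ Suc k) sums (scale t * 1)"
    by (intro sums_mult power_half_series)
  have "norm (coord e t) \<le> (\<Sum>k. scale t * (1/2) ^ Suc k)"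
    unfolding coord_def using weight_le_scale[of _ t] weight_nonneg[of _ t]
    by (intro norm_suminf_le sums_summable[OF s])
      (simp add: abs_mult signs_abs[OF assms] power_divide)
  then show ?thesis using sums_unique[OF s] by simp
qed

lemma continuous_on_coord: assumes e: "signs e" shows "continuous_on {0..} (coord e)"
  unfolding continuous_on_eq_continuous_within
proof
  fix t :: real assume "t \<in> {0..}"
  then consider "t = 0" | "t > 0" by force
  then show "continuous (at t within {0..}) (coord e)"
  proof cases
    case 1
    have b: "norm (coord e s) \<le> norm (s ^ 3) * growth" if "s \<in> {0..}" for s
      using abs_coord_le[OF e, of s] scale_le_cube[of s] that by (simp add: mult.commute)
    have l: "((\<lambda>s::real. s ^ 3) \<longlongrightarrow> 0) (at 0 within {0..})"
      by (rule tendsto_eq_intros refl | simp)+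
    have "\<forall>\<^sub>F s in at 0 within {0..}. norm (coord e s) \<le> norm (s ^ 3) * growth"
      unfolding eventually_at_filter by (intro always_eventually allI impI b)
    then have "(coord e \<longlongrightarrow> 0) (at 0 within {0..})"
      by (rule tendsto_0_le[OF l])
    moreover have "coord e 0 = 0" using abs_coord_le[OF e, of 0] by (simp add: scale_def)
    ultimately show ?thesis using 1 by (simp add: continuous_within)
  next
    case 2
    then obtain N where N: "inverse (real (Suc N)) < t" using reals_Archimedean by blast
    have "1 / (real N + 2) < t"
      by (rule le_less_trans[OF _ N]) (simp add: field_simps)
    then have "isCont (coord e) t" by (rule DERIV_isCont[OF has_real_derivative_coord[OF e]])
    then show ?thesis by (rule continuous_at_imp_continuous_at_within)
  qed
qed

text \<open>The next digit splits the cell numbered \<open>j\<close> into halves numbered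
  \<open>2 * j\<close> and \<open>2 * j + 1\<close>. Thus the centres are midpoints of the cells of
  mesh \<open>1 / 2 ^ n\<close>, where the staircase has its plateaus.\<close>

lemma centre_half_integer:
  assumes "signs e" obtains j :: int where "centre e n = (1 / 2 ^ n) * (real_of_int j + 1/2)"
proof -
  have "\<exists>j::int. centre e n = (1 / 2 ^ n) * (real_of_int j + 1/2)"
  proof (induction n)
    case 0
    have "e 0 = 1 \<or> e 0 = -1" using assms by (simp add: signs_def)
    then have "centre e 0 = (1 / 2 ^ 0) * (real_of_int 0 + 1/2) \<or>
        centre e 0 = (1 / 2 ^ 0) * (real_of_int (-1) + 1/2)" by (auto simp: centre_def)
    then show ?case by blast
  next
    case (Suc n)
    then obtain j :: int where j: "centre e n = (1 / 2 ^ n) * (real_of_int j + 1/2)" by blast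
    have "e (Suc n) = 1 \<or> e (Suc n) = -1" using assms by (simp add: signs_def)
    then have "centre e (Suc n) = (1 / 2 ^ Suc n) * (real_of_int (2 * j + 1) + 1/2) \<or>
        centre e (Suc n) = (1 / 2 ^ Suc n) * (real_of_int (2 * j) + 1/2)"
      using j by (auto simp: centre_def field_simps)
    then show ?case by blast
  qed
  then show ?thesis using that by blast
qed

lemma abs_centre_le: assumes "signs e" shows "\<bar>centre e n\<bar> \<le> 1 - 1 / 2 ^ Suc n"
proof (induction n)
  case 0 then show ?case using signs_abs[OF assms, of 0] by (simp add: centre_def)
next
  case (Suc n)
  have "centre e (Suc n) = centre e n + e (Suc n) / 2 ^ Suc (Suc n)" by (simp add: centre_def)
  then have "\<bar>centre e (Suc n)\<bar> \<le> \<bar>centre e n\<bar> + 1 / 2 ^ Suc (Suc n)"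
    using signs_abs[OF assms, of "Suc n"] abs_triangle_ineq[of "centre e n" "e (Suc n) / 2 ^ Suc (Suc n)"]
    by simp
  then show ?case using Suc by (simp add: field_simps)
qed

lemma scale_stage_ge:
  assumes "1 / (real n + 2) \<le> t" shows "(2 * r) ^ Suc (Suc n) \<le> scale t"
  using scale_mono[OF assms] scale_inverse_Suc[of "Suc n"] by (simp add: add.commute)

text \<open>Relative to \<open>scale t\<close> the offset is largest where \<open>scale\<close> is
  smallest, at the early end of the stage, where it equals \<open>(2 * r) ^ (n + 2)\<close>. There
  the geometric series for \<open>tail\<close> gives a half-width of
  \<open>1 / (4 * (1 - r))\<close> in units of the mesh \<open>1 / 2 ^ n\<close>. This is below 1/2
  since \<open>r < 1/2\<close>, and the difference is the origin of \<open>slack\<close>.\<close>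

lemma coord_near_centre:
  assumes e: "signs e" and t: "1 / (real n + 2) \<le> t" "t \<le> 1 / (real n + 1)"
  shows "\<bar>coord e t / scale t - centre e n\<bar> \<le> (1 / 2 ^ n) * (1/2 - slack)" "\<bar>coord e t / scale t\<bar> \<le> 1"
proof -
  have s: "scale t > 0" "(2 * r) ^ Suc (Suc n) \<le> scale t" "(2 * r) ^ Suc (Suc n) > 0"
    using scale_stage_ge[OF t(1)] r_pos by (auto intro: less_le_trans[rotated])
  have "coord e t / scale t - centre e n = tail e n / scale t"
    using s(1) by (simp add: coord_stage[OF e t] field_simps)
  then have "\<bar>coord e t / scale t - centre e n\<bar> = \<bar>tail e n\<bar> / scale t" using s(1) by simp
  also have "\<dots> \<le> (r ^ Suc (Suc n) / (1 - r)) / (2 * r) ^ Suc (Suc n)"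
    using abs_tail_le[OF e, of n] s r_pos r_half by (intro frac_le) auto
  also have "\<dots> = (1 / 2 ^ n) * (1 / (4 * (1 - r)))"
    using r_pos r_half by (simp add: power_mult_distrib field_simps)
  also have "1 / (4 * (1 - r)) = 1/2 - slack"
    using r_half by (simp add: slack_def field_simps)
  finally show 1: "\<bar>coord e t / scale t - centre e n\<bar> \<le> (1 / 2 ^ n) * (1/2 - slack)" .
  have "(1 / 2 ^ n) * (1/2 - slack) \<le> (1 / 2 ^ n) * (1/2)" using slack_bounds by (intro mult_left_mono) auto
  then show "\<bar>coord e t / scale t\<bar> \<le> 1" using 1 abs_centre_le[OF e, of n] by simp
qed

lemma velocity_on_trajectory:
  assumes e: "signs e" "signs e'" and t: "1 / (real n + 2) \<le> t" "t \<le> 1 / (real n + 1)"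
  shows "velocity t (vector [coord e t, coord e' t]) =
    vector [scale' t * centre e n, scale' t * centre e' n]"
proof -
  have *: "profile slack (1 / 2 ^ n) (coord e t / scale t) (coord e' t / scale t) = centre e n"
    if e: "signs e" "signs e'" for e e'
  proof -
    obtain i j where i: "centre e n = (1 / 2 ^ n) * (real_of_int i + 1/2)"
      and j: "centre e' n = (1 / 2 ^ n) * (real_of_int j + 1/2)"
      using centre_half_integer[OF e(1)] centre_half_integer[OF e(2)] by metis
    show ?thesis unfolding i
      using coord_near_centre[OF e(1) t] coord_near_centre[OF e(2) t]
      by (intro profile_plateau[where j = j] slack_bounds) (auto simp: i j)
  qed
  show ?thesis
    unfolding velocity_eq_mode[OF t] mode_def clip_eq[OF t] Let_def by (simp add: * e)
qed

lemma trajectory_derivative: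
  assumes e: "signs e" "signs e'" and t: "t > 0"
  shows "((\<lambda>t. vector [coord e t, coord e' t] :: real^2) has_vector_derivative
    velocity t (vector [coord e t, coord e' t])) (at t)"
proof -
  have *: "((\<lambda>t. vector [coord e t, coord e' t] :: real^2) has_vector_derivative vector [a, b]) (at t)"
    if "(coord e has_real_derivative a) (at t)" "(coord e' has_real_derivative b) (at t)" for a b
    unfolding vector2_eq using that
    by (auto intro!: derivative_eq_intros simp: has_real_derivative_iff_has_vector_derivative)
  show ?thesis
  proof (cases "t \<ge> 1")
    case True
    then show ?thesis
      using *[OF has_real_derivative_coord_late[OF e(1) True] has_real_derivative_coord_late[OF e(2) True]]
      by (simp add: velocity_zero vector2_eq)
  next
    case False
    then obtain n where n: "1 / (real n + 2) < t" "t \<le> 1 / (real n + 1)"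
      using stage_exists[of t] t by auto
    show ?thesis
      unfolding velocity_on_trajectory[OF e less_imp_le[OF n(1)] n(2)]
      by (intro * has_real_derivative_coord_stage e n)
  qed
qed

end

section \<open>Transport of the measure\<close>

abbreviation unit_measure :: "real measure" where
  "unit_measure \<equiv> restrict_space lborel {0..<1}"

text \<open>The \<open>j\<close>-th binary digit as a sign, a Rademacher function. On
  \<open>{0..<1}\<close> digit 0 is constantly 1, so the digits that carry information start at
  \<open>j = 1\<close>.\<close>

definition digit :: "nat \<Rightarrow> real \<Rightarrow> real" where
  "digit j \<theta> = (if even \<lfloor>2 ^ j * \<theta>\<rfloor> then 1 else -1)"

lemma space_unit_measure: "space unit_measure = {0..<1}"
  by (simp add: space_restrict_space)

lemma emeasure_space_unit_measure: "emeasure unit_measure (space unit_measure) = 1"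
  by (simp add: space_restrict_space emeasure_restrict_space)

lemma unit_interval_unit_measure [simp]:
  "{0..<1} \<in> sets unit_measure" "emeasure unit_measure {0..<1} = 1"
  using sets.top[of unit_measure] emeasure_space_unit_measure by (simp_all only: space_unit_measure)

lemma finite_measure_unit_measure: "finite_measure unit_measure"
  by (rule finite_measureI) (simp only: emeasure_space_unit_measure, simp)

lemma measurable_digit [measurable]: "digit j \<in> borel_measurable borel"
  unfolding digit_def[abs_def] by measurable

lemma measurable_unit_measureI: "f \<in> borel_measurable borel \<Longrightarrow> f \<in> measurable unit_measure borel"
  by (intro measurable_restrict_space1) simp

text \<open>The strip of times and labels has finite measure and \<open>G\<close> is bounded, so
  joint measurability of \<open>X\<close> yields integrability. The first conclusion supplies the
  integrability in time that \<open>weakly_advected\<close> demands.\<close>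

lemma Fubini_strip:
  fixes G :: "real \<times> (real^2) \<Rightarrow> real" and X :: "real \<Rightarrow> real \<Rightarrow> real^2"
  assumes G: "continuous_on UNIV G" "\<And>p. \<bar>G p\<bar> \<le> B"
    and X: "(\<lambda>(t, \<theta>). X t \<theta>) \<in> borel_measurable borel"
  shows "set_integrable lborel {0..T} (\<lambda>t. \<integral>\<theta>. G (t, X t \<theta>) \<partial>unit_measure)"
    and "integrable unit_measure (\<lambda>\<theta>. LINT t:{0..T}|lborel. G (t, X t \<theta>))"
    and "(LINT t:{0..T}|lborel. \<integral>\<theta>. G (t, X t \<theta>) \<partial>unit_measure) =
      (\<integral>\<theta>. (LINT t:{0..T}|lborel. G (t, X t \<theta>)) \<partial>unit_measure)"
proof -
  interpret U: finite_measure unit_measure by (rule finite_measure_unit_measure)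
  interpret P: pair_sigma_finite lborel unit_measure ..
  define H where "H = (\<lambda>p::real \<times> real. indicator {0..T} (fst p) *\<^sub>R G (fst p, X (fst p) (snd p)))"
  have G': "G \<in> borel_measurable borel" using G(1) by (rule borel_measurable_continuous_onI)
  have "snd \<in> borel_measurable (lborel \<Otimes>\<^sub>M unit_measure)"
    by (rule measurable_compose[OF measurable_snd, of "\<lambda>x. x", simplified])
      (rule measurable_unit_measureI, simp)
  moreover have "fst \<in> borel_measurable (lborel \<Otimes>\<^sub>M unit_measure)" by measurable
  ultimately have id: "(\<lambda>p. (fst p, snd p)) \<in> measurable (lborel \<Otimes>\<^sub>M unit_measure) (borel :: (real \<times> real) measure)"
    by (intro borel_measurable_Pair)
  have X': "(\<lambda>p. X (fst p) (snd p)) \<in> borel_measurable (lborel \<Otimes>\<^sub>M unit_measure)"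
    using measurable_compose[OF id X] by (simp add: case_prod_beta)
  have f: "fst \<in> borel_measurable (lborel \<Otimes>\<^sub>M unit_measure)" by measurable
  have GX: "(\<lambda>p. G (fst p, X (fst p) (snd p))) \<in> borel_measurable (lborel \<Otimes>\<^sub>M unit_measure)"
    by (rule measurable_compose[OF _ G']) (intro borel_measurable_Pair f X')
  have i: "integrable (lborel \<Otimes>\<^sub>M unit_measure) H"
  proof (rule integrableI_bounded_set[where A = "{0..T} \<times> space unit_measure" and B = "\<bar>B\<bar>"])
    show "{0..T} \<times> space unit_measure \<in> sets (lborel \<Otimes>\<^sub>M unit_measure)"
      by (intro pair_measureI sets.top) auto
    show "emeasure (lborel \<Otimes>\<^sub>M unit_measure) ({0..T} \<times> space unit_measure) < \<infinity>"
      by (subst U.emeasure_pair_measure_Times) (auto simp: emeasure_lborel_Icc_eq)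
    show "H \<in> borel_measurable (lborel \<Otimes>\<^sub>M unit_measure)"
      unfolding H_def using GX by measurable
    show "AE p in lborel \<Otimes>\<^sub>M unit_measure. p \<in> {0..T} \<times> space unit_measure \<longrightarrow> norm (H p) \<le> \<bar>B\<bar>"
      using order_trans[OF G(2) abs_ge_self] by (intro AE_I2) (simp add: H_def indicator_def)
    show "AE p in lborel \<Otimes>\<^sub>M unit_measure. p \<notin> {0..T} \<times> space unit_measure \<longrightarrow> H p = 0"
      by (intro AE_I2) (auto simp: H_def indicator_def space_pair_measure)
  qed
  show "set_integrable lborel {0..T} (\<lambda>t. \<integral>\<theta>. G (t, X t \<theta>) \<partial>unit_measure)"
    using P.integrable_fst'[OF i] by (simp add: H_def set_integrable_def)
  have i': "integrable (lborel \<Otimes>\<^sub>M unit_measure) (\<lambda>(t, \<theta>). H (t, \<theta>))" using i by simp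
  show "integrable unit_measure (\<lambda>\<theta>. LINT t:{0..T}|lborel. G (t, X t \<theta>))"
    using P.integrable_snd[OF i'] by (simp add: H_def set_lebesgue_integral_def)
  show "(LINT t:{0..T}|lborel. \<integral>\<theta>. G (t, X t \<theta>) \<partial>unit_measure) =
      (\<integral>\<theta>. (LINT t:{0..T}|lborel. G (t, X t \<theta>)) \<partial>unit_measure)"
    using P.Fubini_integral[OF i'] by (simp add: H_def set_lebesgue_integral_def)
qed

lemma bounded_continuous_compact_support:
  fixes f :: "'a::euclidean_space \<Rightarrow> real"
  assumes "continuous_on UNIV f" "compact K" "\<And>x. x \<notin> K \<Longrightarrow> f x = 0"
  obtains B where "\<And>x. \<bar>f x\<bar> \<le> B"
proof -
  have "bounded (f ` K)"
    by (intro compact_imp_bounded compact_continuous_image assms continuous_on_subset[OF assms(1)]) auto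
  then obtain B where B: "B > 0" "\<And>x. x \<in> K \<Longrightarrow> norm (f x) \<le> B" unfolding bounded_pos by auto
  have "\<bar>f x\<bar> \<le> B" for x using B assms(3)[of x] by (cases "x \<in> K") auto
  then show ?thesis using that by blast
qed

text \<open>For a fixed label the fundamental theorem of calculus for \<open>\<phi>\<close> along
  the trajectory is already the desired identity; integrating over the labels and exchanging the
  integrals does the rest. Derivatives are required for \<open>t > 0\<close> only, so the splitting
  at time 0 does no harm: continuity suffices there.\<close>

lemma weakly_advected_trajectories:
  fixes X :: "real \<Rightarrow> real \<Rightarrow> real^2"
  assumes u: "continuous_on UNIV (\<lambda>(t, x). u t x)" and T: "T > 0"
    and meas: "(\<lambda>(t, \<theta>). X t \<theta>) \<in> borel_measurable borel"
    and cont: "\<And>\<theta>. continuous_on {0..} (\<lambda>t. X t \<theta>)"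
    and deriv: "\<And>\<theta> t. t > 0 \<Longrightarrow> ((\<lambda>t. X t \<theta>) has_vector_derivative u t (X t \<theta>)) (at t)"
  shows "weakly_advected u (\<lambda>t. distr unit_measure borel (X t)) T"
  unfolding weakly_advected_def Let_def
proof (intro allI impI)
  fix \<phi> :: "real \<times> (real^2) \<Rightarrow> real" assume \<phi>: "test_fun \<phi>"
  interpret U: finite_measure unit_measure by (rule finite_measure_unit_measure)
  define G1 where "G1 = (\<lambda>p. frechet_derivative \<phi> (at p) (1, 0))"
  define G2 where "G2 = (\<lambda>p. frechet_derivative \<phi> (at p) (0, u (fst p) (snd p)))"
  have c1: "continuous_on UNIV G1" unfolding G1_def
    by (intro continuous_on_frechet_derivative_test_fun \<phi> continuous_intros)
  have c2: "continuous_on UNIV G2" unfolding G2_def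
    using u by (intro continuous_on_frechet_derivative_test_fun \<phi> continuous_intros) (simp add: case_prod_beta)
  have K: "compact (fun_support \<phi>)" by (rule test_fun_compact_support[OF \<phi>])
  obtain B1 where B1: "\<And>p. \<bar>G1 p\<bar> \<le> B1"
    using bounded_continuous_compact_support[OF c1 K] by (auto simp: G1_def frechet_derivative_outside_support)
  obtain B2 where B2: "\<And>p. \<bar>G2 p\<bar> \<le> B2"
    using bounded_continuous_compact_support[OF c2 K] by (auto simp: G2_def frechet_derivative_outside_support)
  have c: "continuous_on UNIV \<phi>" by (rule test_fun_continuous[OF \<phi>])
  obtain B where B: "\<And>p. \<bar>\<phi> p\<bar> \<le> B"
    using bounded_continuous_compact_support[OF c K] by (auto simp: outside_fun_support)
  have Xm: "X t \<in> measurable unit_measure borel" for t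
  proof (rule measurable_unit_measureI)
    have "(\<lambda>\<theta>. (t, \<theta>)) \<in> measurable borel (borel :: (real \<times> real) measure)" by measurable
    from measurable_compose[OF this meas] show "X t \<in> borel_measurable borel" by simp
  qed
  have slice: "(\<lambda>x. G (t, x)) \<in> borel_measurable borel" if "continuous_on UNIV G" for G :: "_ \<Rightarrow> real" and t :: real
    using that by (intro borel_measurable_continuous_onI continuous_on_compose2[OF that] continuous_intros) auto
  have distr: "(\<integral>x. G (t, x) \<partial>distr unit_measure borel (X t)) = (\<integral>\<theta>. G (t, X t \<theta>) \<partial>unit_measure)"
    if "continuous_on UNIV G" for G :: "_ \<Rightarrow> real" and t
    by (rule integral_distr[OF Xm slice[OF that]])
  have \<phi>i: "integrable unit_measure (\<lambda>\<theta>. \<phi> (t, X t \<theta>))" for t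
    using B measurable_compose[OF Xm slice[OF c]]
    by (intro U.integrable_const_bound[where B = B]) auto
  have ftc: "(LINT t:{0..T}|lborel. G1 (t, X t \<theta>)) + (LINT t:{0..T}|lborel. G2 (t, X t \<theta>)) =
      \<phi> (T, X T \<theta>) - \<phi> (0, X 0 \<theta>)" for \<theta>
  proof -
    have cX: "continuous_on {0..T} (\<lambda>t. X t \<theta>)" using cont by (rule continuous_on_subset) auto
    have cG: "continuous_on {0..T} (\<lambda>t. G (t, X t \<theta>))" if "continuous_on UNIV G" for G :: "_ \<Rightarrow> real"
      by (intro continuous_on_compose2[OF that] continuous_intros cX) auto
    have si: "set_integrable lborel {0..T} (\<lambda>t. G (t, X t \<theta>))" if "continuous_on UNIV G" for G :: "_ \<Rightarrow> real"
      by (intro borel_integrable_atLeastAtMost' cG that)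
    have "((\<lambda>t. G1 (t, X t \<theta>) + G2 (t, X t \<theta>)) has_integral \<phi> (T, X T \<theta>) - \<phi> (0, X 0 \<theta>)) {0..T}"
    proof (rule fundamental_theorem_of_calculus_interior)
      show "0 \<le> T" using T by simp
      show "continuous_on {0..T} (\<lambda>t. \<phi> (t, X t \<theta>))" by (rule cG[OF c])
      fix t assume "t \<in> {0<..<T}"
      then have t: "t > 0" by simp
      have "((\<lambda>t. (t, X t \<theta>)) has_vector_derivative (1, u t (X t \<theta>))) (at t)"
        by (intro has_vector_derivative_Pair deriv t) (auto intro!: derivative_eq_intros)
      then have "((\<lambda>t. (t, X t \<theta>)) has_derivative (\<lambda>s. s *\<^sub>R (1, u t (X t \<theta>)))) (at t)"
        by (simp add: has_vector_derivative_def)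
      from has_derivative_compose[OF this test_fun_has_derivative[OF \<phi>]]
      have "((\<lambda>t. \<phi> (t, X t \<theta>)) has_derivative
          (\<lambda>s. frechet_derivative \<phi> (at (t, X t \<theta>)) (s *\<^sub>R (1, u t (X t \<theta>))))) (at t)" .
      moreover have l: "linear (frechet_derivative \<phi> (at p))" for p
        using test_fun_has_derivative[OF \<phi>] has_derivative_linear by blast
      have "frechet_derivative \<phi> (at (t, X t \<theta>)) (s *\<^sub>R (1, u t (X t \<theta>))) =
          s *\<^sub>R (G1 (t, X t \<theta>) + G2 (t, X t \<theta>))" for s
        using linear_add[OF l, of "(t, X t \<theta>)" "(1, 0)" "(0, u t (X t \<theta>))"]
        unfolding linear_cmul[OF l] by (simp add: G1_def G2_def)
      ultimately show "((\<lambda>t. \<phi> (t, X t \<theta>)) has_vector_derivative G1 (t, X t \<theta>) + G2 (t, X t \<theta>)) (at t)"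
        by (simp add: has_vector_derivative_def)
    qed
    then have "integral {0..T} (\<lambda>t. G1 (t, X t \<theta>) + G2 (t, X t \<theta>)) = \<phi> (T, X T \<theta>) - \<phi> (0, X 0 \<theta>)"
      by (rule integral_unique)
    moreover have "integral {0..T} (\<lambda>t. G1 (t, X t \<theta>) + G2 (t, X t \<theta>)) =
        integral {0..T} (\<lambda>t. G1 (t, X t \<theta>)) + integral {0..T} (\<lambda>t. G2 (t, X t \<theta>))"
      by (intro Henstock_Kurzweil_Integration.integral_add integrable_continuous_interval cG c1 c2)
    ultimately show ?thesis
      by (simp add: set_borel_integral_eq_integral(2)[OF si[OF c1]] set_borel_integral_eq_integral(2)[OF si[OF c2]])
  qed
  note F1 = Fubini_strip[OF c1 B1 meas, of T] and F2 = Fubini_strip[OF c2 B2 meas, of T]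
  have "(LINT t:{0..T}|lborel. \<integral>\<theta>. G1 (t, X t \<theta>) \<partial>unit_measure) +
      (LINT t:{0..T}|lborel. \<integral>\<theta>. G2 (t, X t \<theta>) \<partial>unit_measure) =
      (\<integral>\<theta>. \<phi> (T, X T \<theta>) - \<phi> (0, X 0 \<theta>) \<partial>unit_measure)"
    unfolding F1(3) F2(3) by (simp add: Bochner_Integration.integral_add[OF F1(2) F2(2), symmetric] ftc)
  also have "\<dots> = (\<integral>\<theta>. \<phi> (T, X T \<theta>) \<partial>unit_measure) - (\<integral>\<theta>. \<phi> (0, X 0 \<theta>) \<partial>unit_measure)"
    by (rule Bochner_Integration.integral_diff[OF \<phi>i \<phi>i])
  finally have main: "(LINT t:{0..T}|lborel. \<integral>\<theta>. G1 (t, X t \<theta>) \<partial>unit_measure) +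
      (LINT t:{0..T}|lborel. \<integral>\<theta>. G2 (t, X t \<theta>) \<partial>unit_measure) =
      (\<integral>\<theta>. \<phi> (T, X T \<theta>) \<partial>unit_measure) - (\<integral>\<theta>. \<phi> (0, X 0 \<theta>) \<partial>unit_measure)" .
  have e1: "(\<integral>x. frechet_derivative \<phi> (at (t, x)) (1, 0) \<partial>distr unit_measure borel (X t)) =
      (\<integral>\<theta>. G1 (t, X t \<theta>) \<partial>unit_measure)" for t using distr[OF c1, of t] by (simp add: G1_def)
  have e2: "(\<integral>x. frechet_derivative \<phi> (at (t, x)) (0, u t x) \<partial>distr unit_measure borel (X t)) =
      (\<integral>\<theta>. G2 (t, X t \<theta>) \<partial>unit_measure)" for t using distr[OF c2, of t] by (simp add: G2_def)
  show "set_integrable lborel {0..T} (\<lambda>t. \<integral>x. frechet_derivative \<phi> (at (t, x)) (1, 0) \<partial>distr unit_measure borel (X t)) \<and>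
     set_integrable lborel {0..T} (\<lambda>t. \<integral>x. frechet_derivative \<phi> (at (t, x)) (0, u t x) \<partial>distr unit_measure borel (X t)) \<and>
     (LINT t:{0..T}|lborel. \<integral>x. frechet_derivative \<phi> (at (t, x)) (1, 0) \<partial>distr unit_measure borel (X t)) -
       (\<integral>x. \<phi> (T, x) \<partial>distr unit_measure borel (X T)) + (\<integral>x. \<phi> (0, x) \<partial>distr unit_measure borel (X 0)) +
       (LINT t:{0..T}|lborel. \<integral>x. frechet_derivative \<phi> (at (t, x)) (0, u t x) \<partial>distr unit_measure borel (X t)) = 0"
    unfolding e1 e2 distr[OF c] using F1(1) F2(1) main by simp
qed

context cantor_flow
begin

text \<open>Odd binary digits of the label \<open>\<theta>\<close> determine the first coordinate, even ones the second.\<close>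

definition position :: "real \<Rightarrow> real \<Rightarrow> real^2" where
  "position t \<theta> = vector [coord (\<lambda>k. digit (2 * k + 1) \<theta>) t, coord (\<lambda>k. digit (2 * k + 2) \<theta>) t]"

lemma signs_digit: "signs (\<lambda>k. digit (f k) \<theta>)"
  by (simp add: signs_def digit_def)

lemma measurable_scale [measurable]: "scale \<in> borel_measurable borel"
  by (intro borel_measurable_mono monoI scale_mono)

lemma measurable_position: "(\<lambda>(t, \<theta>). position t \<theta>) \<in> borel_measurable borel"
proof -
  have "(\<lambda>p. coord (\<lambda>k. digit (f k) (snd p)) (fst p)) \<in> borel_measurable (borel \<Otimes>\<^sub>M borel)" for f
    unfolding coord_def weight_def by measurable
  then have "(\<lambda>p. position (fst p) (snd p)) \<in> borel_measurable (borel \<Otimes>\<^sub>M borel)"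
    unfolding position_def vector2_eq by (intro borel_measurable_add borel_measurable_scaleR) auto
  then show ?thesis by (simp add: borel_prod case_prod_beta)
qed

lemma measurable_position_slice: "position t \<in> measurable unit_measure borel"
proof (rule measurable_unit_measureI)
  have "(\<lambda>\<theta>. (t, \<theta>)) \<in> measurable borel (borel :: (real \<times> real) measure)" by measurable
  from measurable_compose[OF this measurable_position] show "position t \<in> borel_measurable borel" by simp
qed

definition cantor_measure :: "real \<Rightarrow> (real^2) measure" where
  "cantor_measure t = distr unit_measure borel (position t)"

lemma emeasure_cantor_measure:
  "A \<in> sets borel \<Longrightarrow> emeasure (cantor_measure t) A = emeasure unit_measure (position t -` A \<inter> {0..<1})"
  unfolding cantor_measure_def
  by (simp add: emeasure_distr[OF measurable_position_slice] space_unit_measure)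

lemma locally_finite_cantor_measure: "locally_finite_borel (cantor_measure t)"
proof -
  interpret U: finite_measure unit_measure by (rule finite_measure_unit_measure)
  have "emeasure (cantor_measure t) K < \<infinity>" if "compact K" for K
    using that U.emeasure_finite by (simp add: emeasure_cantor_measure borel_compact less_top[symmetric])
  then show ?thesis by (simp add: locally_finite_borel_def cantor_measure_def)
qed

lemma weakly_advected_cantor_measure:
  assumes "T > 0" shows "weakly_advected velocity cantor_measure T"
proof -
  have "continuous_on {0..} (\<lambda>t. position t \<theta>)" for \<theta>
    unfolding position_def vector2_eq by (intro continuous_intros continuous_on_coord signs_digit)
  then have "weakly_advected velocity (\<lambda>t. distr unit_measure borel (position t)) T"
    using trajectory_derivative[OF signs_digit signs_digit]
    by (intro weakly_advected_trajectories continuous_on_velocity assms measurable_position)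
      (auto simp: position_def)
  then show ?thesis by (simp add: cantor_measure_def[abs_def])
qed

lemma position_0: "position 0 \<theta> = 0"
proof -
  have "coord e 0 = 0" if "signs e" for e using abs_coord_le[OF that, of 0] by (simp add: scale_def)
  then show ?thesis by (simp add: position_def signs_digit vector2_eq)
qed

lemma support_cantor_measure_0: "measure_support (cantor_measure 0) = {0}"
proof -
  have "emeasure (cantor_measure 0) (ball x d) = indicator (ball x d) 0" for x :: "real^2" and d
    using emeasure_space_unit_measure
    by (simp add: emeasure_cantor_measure position_0 vimage_def space_unit_measure indicator_def)
  then have "x \<in> measure_support (cantor_measure 0) \<longleftrightarrow> (\<forall>d>0. norm x < d)" for x :: "real^2"
    by (auto simp: measure_support_def indicator_def)
  moreover have "(\<forall>d>0. norm x < d) \<longleftrightarrow> x = 0" for x :: "real^2"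
    by (metis norm_eq_zero norm_ge_zero order_less_irrefl order_less_le)
  ultimately show ?thesis by auto
qed

end

section \<open>Hausdorff dimension of the support\<close>

lemma floor_double: "\<lfloor>2 * y\<rfloor> = 2 * \<lfloor>y\<rfloor> \<or> \<lfloor>2 * y\<rfloor> = 2 * \<lfloor>y\<rfloor> + 1" for y :: real
  by linarith

lemma floor_double_cong: "\<lfloor>2 * y\<rfloor> = \<lfloor>2 * z\<rfloor> \<Longrightarrow> \<lfloor>y\<rfloor> = \<lfloor>z\<rfloor>" for y z :: real
  using floor_double[of y] floor_double[of z] by presburger

lemma floor_double_eqI:
  fixes y z :: real
  assumes "\<lfloor>y\<rfloor> = \<lfloor>z\<rfloor>" "even \<lfloor>2 * y\<rfloor> \<longleftrightarrow> even \<lfloor>2 * z\<rfloor>"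
  shows "\<lfloor>2 * y\<rfloor> = \<lfloor>2 * z\<rfloor>"
  using assms floor_double[of y] floor_double[of z] by presburger

lemma digit_eqI:
  assumes "\<lfloor>2 ^ n * \<theta>\<rfloor> = \<lfloor>2 ^ n * \<theta>'\<rfloor>" "j \<le> n" shows "digit j \<theta> = digit j \<theta>'"
proof -
  have "\<lfloor>2 ^ j * \<theta>\<rfloor> = \<lfloor>2 ^ j * \<theta>'\<rfloor>" using assms(2,1)
  proof (induction rule: inc_induct)
    case (step m)
    have "\<lfloor>2 * (2 ^ m * \<theta>)\<rfloor> = \<lfloor>2 * (2 ^ m * \<theta>')\<rfloor>" using step by (simp add: mult.assoc)
    then show ?case by (rule floor_double_cong)
  qed
  then show ?thesis by (simp add: digit_def)
qed

text \<open>Both labels start in the same interval because their floors are 0, which is where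
  \<open>{0..<1}\<close> enters; each further digit selects one half of the current dyadic
  interval.\<close>

lemma floor_eq_if_digits_eq:
  assumes "\<theta> \<in> {0..<1}" "\<theta>' \<in> {0..<1}" "\<And>j. 1 \<le> j \<Longrightarrow> j \<le> n \<Longrightarrow> digit j \<theta> = digit j \<theta>'"
  shows "\<lfloor>2 ^ n * \<theta>\<rfloor> = \<lfloor>2 ^ n * \<theta>'\<rfloor>"
  using assms(3)
proof (induction n)
  case 0
  have "\<lfloor>\<theta>\<rfloor> = 0" "\<lfloor>\<theta>'\<rfloor> = 0" using assms by (auto simp: floor_eq_iff)
  then show ?case by simp
next
  case (Suc n)
  have "\<lfloor>2 ^ n * \<theta>\<rfloor> = \<lfloor>2 ^ n * \<theta>'\<rfloor>" using Suc by simp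
  moreover have "digit (Suc n) \<theta> = digit (Suc n) \<theta>'" using Suc.prems by simp
  then have "even \<lfloor>2 * (2 ^ n * \<theta>)\<rfloor> \<longleftrightarrow> even \<lfloor>2 * (2 ^ n * \<theta>')\<rfloor>"
    by (simp add: digit_def mult.assoc split: if_splits)
  ultimately have "\<lfloor>2 * (2 ^ n * \<theta>)\<rfloor> = \<lfloor>2 * (2 ^ n * \<theta>')\<rfloor>" by (rule floor_double_eqI)
  then show ?case by (simp add: mult.assoc)
qed

text \<open>Base 4 reads the binary digits in pairs, one for each coordinate. A cylinder of level
  \<open>n\<close> thus fixes the first \<open>n\<close> signs of both coordinates and corresponds
  to one of the \<open>4 ^ n\<close> squares.\<close>

definition cylinder :: "nat \<Rightarrow> int \<Rightarrow> real set" where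
  "cylinder n j = {\<theta> \<in> {0..<1}. \<lfloor>4 ^ n * \<theta>\<rfloor> = j}"

lemma cylinder_eq: "cylinder n j = {j / 4 ^ n ..< (j + 1) / 4 ^ n} \<inter> {0..<1}"
  by (auto simp: cylinder_def floor_eq_iff field_simps)

lemma emeasure_unit_measure: "A \<in> sets borel \<Longrightarrow> A \<subseteq> {0..<1} \<Longrightarrow> emeasure unit_measure A = emeasure lborel A"
  by (rule emeasure_restrict_space) auto

lemma emeasure_cylinder_le: "emeasure unit_measure (cylinder n j) \<le> ennreal (1 / 4 ^ n)"
proof -
  have "emeasure unit_measure (cylinder n j) = emeasure lborel (cylinder n j)"
    by (rule emeasure_unit_measure) (auto simp: cylinder_eq)
  also have "\<dots> \<le> emeasure lborel {real_of_int j / 4 ^ n ..< (j + 1) / 4 ^ n}"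
    unfolding cylinder_eq by (intro emeasure_mono) auto
  also have "\<dots> = ennreal (1 / 4 ^ n)"
    by (subst emeasure_lborel_Ico) (auto simp: divide_right_mono diff_divide_distrib[symmetric])
  finally show ?thesis .
qed

lemma emeasure_cylinder_pos:
  fixes \<theta> :: real
  assumes "\<theta> \<in> {0..<1}" shows "emeasure unit_measure (cylinder n \<lfloor>4 ^ n * \<theta>\<rfloor>) > 0"
proof -
  define j where "j = \<lfloor>4 ^ n * \<theta>\<rfloor>"
  have j: "0 \<le> j" "j < 4 ^ n"
    using assms by (auto simp: j_def floor_less_iff)
  then have "real_of_int (j + 1) \<le> real_of_int (4 ^ n)" by (simp only: of_int_le_iff)
  then have "real_of_int j + 1 \<le> 4 ^ n" by simp
  then have "(real_of_int j + 1) / 4 ^ n \<le> 1" by simp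
  then have "{real_of_int j / 4 ^ n <..< (j + 1) / 4 ^ n} \<subseteq> cylinder n j"
    using j by (auto simp: cylinder_eq intro: order_trans[of 0 "real_of_int j / 4 ^ n"])
  then have le: "emeasure lborel {real_of_int j / 4 ^ n <..< (j + 1) / 4 ^ n} \<le> emeasure lborel (cylinder n j)"
    by (intro emeasure_mono) (auto simp: cylinder_eq)
  have "0 < ennreal (1 / 4 ^ n)" by simp
  also have "ennreal (1 / 4 ^ n) = emeasure lborel {real_of_int j / 4 ^ n <..< (j + 1) / 4 ^ n}"
    by (subst emeasure_lborel_Ioo) (auto simp: divide_right_mono diff_divide_distrib[symmetric])
  also note le
  also have "emeasure lborel (cylinder n j) = emeasure unit_measure (cylinder n j)"
    by (rule emeasure_unit_measure[symmetric]) (auto simp: cylinder_eq)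
  finally show ?thesis by (simp only: j_def)
qed

lemma cylinder_cover: "{0..<1} = (\<Union>i<4 ^ n. cylinder n (int i))"
proof -
  have "\<theta> \<in> (\<Union>i<4 ^ n. cylinder n (int i))" if "\<theta> \<in> {0..<1}" for \<theta> :: real
  proof -
    have "0 \<le> \<lfloor>4 ^ n * \<theta>\<rfloor>" "\<lfloor>4 ^ n * \<theta>\<rfloor> < 4 ^ n"
      using that by (auto simp: floor_less_iff)
    then have "nat \<lfloor>4 ^ n * \<theta>\<rfloor> < 4 ^ n" "\<theta> \<in> cylinder n (int (nat \<lfloor>4 ^ n * \<theta>\<rfloor>))"
      using that by (auto simp: cylinder_def nat_less_iff)
    then show ?thesis by blast
  qed
  then show ?thesis by (auto simp: cylinder_def)
qed

lemma power_powr_commute: "r \<ge> 0 \<Longrightarrow> (r ^ n) powr s = (r powr s) ^ n" for r s :: real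
  by (induction n) (auto simp: powr_mult)

lemma norm_real2_le: "norm (x :: real^2) \<le> \<bar>x $ 1\<bar> + \<bar>x $ 2\<bar>"
  using norm_le_l1_cart[of x] by (simp add: sum_2)

context cantor_flow
begin

section \<open>Distances between points in terms of the digits on which they agree\<close>

lemma summable_weight: "summable (\<lambda>k. weight k t)"
proof (rule summable_comparison_test'[OF summable_r_powers[of 1]])
  show "norm (weight k t) \<le> r ^ (k + 1)" for k
    using weight_le[of k t] weight_nonneg[of k t] by simp
qed

lemma summable_weight_shift: "summable (\<lambda>k. weight (k + n) t)"
  by (rule summable_ignore_initial_segment[OF summable_weight])

lemma coord_diff:
  assumes e: "signs e" "signs e'" and agree: "\<And>k. k < n \<Longrightarrow> e k = e' k"
  shows "coord e t - coord e' t = (\<Sum>k. (e (k + n) - e' (k + n)) * weight (k + n) t)"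
    and "summable (\<lambda>k. (e (k + n) - e' (k + n)) * weight (k + n) t)"
proof -
  have s: "summable (\<lambda>k. (e k - e' k) * weight k t)"
    using summable_diff[OF summable_coord[OF e(1)] summable_coord[OF e(2)]] by (simp add: left_diff_distrib)
  have "coord e t - coord e' t = (\<Sum>k. (e k - e' k) * weight k t)"
    unfolding coord_def
    by (subst suminf_diff[OF summable_coord[OF e(1)] summable_coord[OF e(2)]]) (simp add: left_diff_distrib)
  also have "\<dots> = (\<Sum>k. (e (k + n) - e' (k + n)) * weight (k + n) t) + (\<Sum>k<n. (e k - e' k) * weight k t)"
    by (rule suminf_split_initial_segment[OF s])
  also have "(\<Sum>k<n. (e k - e' k) * weight k t) = 0" using agree by simp
  finally show "coord e t - coord e' t = (\<Sum>k. (e (k + n) - e' (k + n)) * weight (k + n) t)" by simp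
  show "summable (\<lambda>k. (e (k + n) - e' (k + n)) * weight (k + n) t)"
    using s by (rule summable_ignore_initial_segment)
qed

lemma abs_signs_diff: "signs e \<Longrightarrow> signs e' \<Longrightarrow> \<bar>e k - e' k\<bar> \<le> 2"
  using signs_abs[of e k] signs_abs[of e' k] by linarith

lemma abs_coord_diff_le:
  assumes e: "signs e" "signs e'" and agree: "\<And>k. k < n \<Longrightarrow> e k = e' k"
  shows "\<bar>coord e t - coord e' t\<bar> \<le> 2 * (r ^ Suc n / (1 - r))"
proof -
  have eq: "coord e t - coord e' t = (\<Sum>k. (e (k + n) - e' (k + n)) * weight (k + n) t)"
    by (rule coord_diff(1)[OF e agree])
  have "norm (coord e t - coord e' t) \<le> (\<Sum>k. 2 * r ^ (k + Suc n))"
    unfolding eq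
  proof (rule norm_suminf_le)
    show "norm ((e (k + n) - e' (k + n)) * weight (k + n) t) \<le> 2 * r ^ (k + Suc n)" for k
      unfolding norm_mult using abs_signs_diff[OF e, of "k + n"] weight_le[of "k + n" t] weight_nonneg[of "k + n" t]
      by (intro mult_mono) auto
  qed (intro summable_mult summable_r_powers)
  also have "\<dots> = 2 * (r ^ Suc n / (1 - r))"
    by (simp only: suminf_mult[OF summable_r_powers] suminf_r_powers)
  finally show ?thesis by simp
qed

text \<open>Half the guaranteed distance between coordinates whose signs first differ at
  \<open>j\<close>: the leading terms differ by \<open>2 * weight j t\<close>, and the later ones
  can undo at most twice the remaining sum.\<close>

definition gap :: "nat \<Rightarrow> real \<Rightarrow> real" where
  "gap j t = weight j t - (\<Sum>k. weight (k + Suc j) t)"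

lemma gap_le_abs_coord_diff:
  assumes e: "signs e" "signs e'" and agree: "\<And>k. k < j \<Longrightarrow> e k = e' k" and "e j \<noteq> e' j"
  shows "2 * gap j t \<le> \<bar>coord e t - coord e' t\<bar>"
proof -
  define f where "f = (\<lambda>k. (e (k + j) - e' (k + j)) * weight (k + j) t)"
  have f: "coord e t - coord e' t = suminf f" "summable f"
    using coord_diff[OF e agree, of j t] by (simp_all add: f_def)
  have "suminf f = (\<Sum>k. f (Suc k)) + f 0"
    using suminf_split_initial_segment[OF f(2), of 1] by simp
  moreover have "norm (\<Sum>k. f (Suc k)) \<le> (\<Sum>k. 2 * weight (k + Suc j) t)"
  proof (rule norm_suminf_le)
    show "norm (f (Suc k)) \<le> 2 * weight (k + Suc j) t" for k
      unfolding f_def norm_mult using abs_signs_diff[OF e, of "Suc k + j"] weight_nonneg[of "Suc k + j" t]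
      by (intro mult_mono) auto
  qed (intro summable_mult summable_weight_shift)
  moreover have "(\<Sum>k. 2 * weight (k + Suc j) t) = 2 * (\<Sum>k. weight (k + Suc j) t)"
    by (rule suminf_mult[OF summable_weight_shift])
  moreover have "\<bar>f 0\<bar> = 2 * weight j t"
  proof -
    have "e j - e' j = 2 \<or> e j - e' j = -2" using assms(4) e unfolding signs_def by (metis diff_minus_eq_add minus_diff_eq one_add_one)
    then show ?thesis using weight_nonneg[of j t] by (auto simp: f_def abs_mult)
  qed
  ultimately show ?thesis unfolding f(1) gap_def by (simp add: algebra_simps)
qed

lemma weight_Suc_le: "2 * weight (Suc k) t \<le> weight k t"
proof -
  have "1 / (real (Suc k) + 1) \<le> 1 / (real k + 1)" by (simp add: frac_le)
  then have "scale (min t (1 / (real (Suc k) + 1))) \<le> scale (min t (1 / (real k + 1)))"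
    by (intro scale_mono) auto
  then show ?thesis by (simp add: weight_def field_simps)
qed

text \<open>The difference of consecutive gaps is
  \<open>weight j t - 2 * weight (Suc j) t\<close>.\<close>

lemma gap_Suc_le: "gap (Suc j) t \<le> gap j t"
proof -
  have "(\<Sum>k. weight (k + Suc j) t) = (\<Sum>k. weight (k + Suc (Suc j)) t) + weight (Suc j) t"
    using suminf_split_initial_segment[OF summable_weight_shift[of "Suc j" t], of 1] by simp
  then show ?thesis using weight_Suc_le[of j t] by (simp add: gap_def)
qed

text \<open>Once the digits are frozen, the geometric series turns the gap into
  \<open>a * r ^ j\<close>, which is positive since \<open>r < 1/2\<close>. The finitely many
  earlier gaps are bounded below by \<open>gap n t\<close> through monotonicity, at the price of a
  constant that depends on \<open>t\<close>.\<close>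

lemma gap_lower_bound:
  assumes "t > 0" obtains c where "c > 0" "\<And>j. c * r ^ j \<le> gap j t"
proof -
  obtain n where n: "inverse (real (Suc n)) < t" using assms reals_Archimedean by blast
  define a where "a = r * (1 - 2 * r) / (1 - r)"
  have a: "a > 0" using r_pos r_half by (simp add: a_def)
  have late: "gap j t = a * r ^ j" if "j \<ge> n" for j
  proof -
    have w: "weight i t = r ^ Suc i" if "i \<ge> n" for i
    proof (rule weight_late)
      have "1 / (real i + 1) \<le> 1 / (real n + 1)" using that by (intro divide_left_mono) auto
      then show "1 / (real i + 1) \<le> t" using n by (simp add: inverse_eq_divide add.commute)
    qed
    have "(\<Sum>k. weight (k + Suc j) t) = (\<Sum>k. r ^ (k + Suc (Suc j)))" using that by (simp add: w)
    also have "\<dots> = r ^ Suc (Suc j) / (1 - r)" by (rule suminf_r_powers)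
    finally have "gap j t = r ^ Suc j - r ^ Suc (Suc j) / (1 - r)" using that by (simp add: gap_def w)
    also have "\<dots> = a * r ^ j" using r_half by (simp add: a_def field_simps)
    finally show ?thesis .
  qed
  have r1: "r ^ j \<le> 1" for j using r_pos r_half by (intro power_le_one) auto
  show thesis
  proof (rule that[of "a * r ^ n"])
    show "0 < a * r ^ n" using a r_pos by simp
    fix j
    show "a * r ^ n * r ^ j \<le> gap j t"
    proof (cases "j \<ge> n")
      case True
      have "a * (r ^ n * r ^ j) \<le> a * (1 * r ^ j)"
        using a r_pos r1[of n] by (intro mult_left_mono mult_right_mono) auto
      then show ?thesis using late[OF True] by simp
    next
      case False
      then have "gap n t \<le> gap j t" by (intro lift_Suc_antimono_le[of "\<lambda>j. gap j t", OF gap_Suc_le]) simp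
      moreover have "a * (r ^ n * r ^ j) \<le> a * (r ^ n * 1)"
        using a r_pos r1[of j] by (intro mult_left_mono) auto
      ultimately show ?thesis using late[of n] by simp
    qed
  qed
qed

text \<open>The bound is uniform in time because no weight exceeds its frozen value
  \<open>r ^ Suc k\<close>.\<close>

lemma dist_position_same_cylinder:
  assumes "\<theta> \<in> cylinder n j" "\<theta>' \<in> cylinder n j"
  shows "norm (position t \<theta> - position t \<theta>') \<le> 4 * r / (1 - r) * r ^ n"
proof -
  have eq: "\<lfloor>2 ^ (2 * n) * \<theta>\<rfloor> = \<lfloor>2 ^ (2 * n) * \<theta>'\<rfloor>"
    using assms by (simp add: cylinder_def power_mult)
  have "\<bar>coord (\<lambda>k. digit (2 * k + i) \<theta>) t - coord (\<lambda>k. digit (2 * k + i) \<theta>') t\<bar> \<le> 2 * (r ^ Suc n / (1 - r))"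
    if "i \<le> 2" for i
    using that by (intro abs_coord_diff_le signs_digit digit_eqI[OF eq]) auto
  from this[of 1] this[of 2] have "norm (position t \<theta> - position t \<theta>') \<le>
      2 * (r ^ Suc n / (1 - r)) + 2 * (r ^ Suc n / (1 - r))"
    by (intro order_trans[OF norm_real2_le] add_mono) (simp_all add: position_def)
  then show ?thesis by (simp add: field_simps)
qed

text \<open>A sufficiently small cylinder around the label is mapped into the given ball, and every
  such cylinder has positive measure.\<close>

lemma position_in_support:
  assumes "\<theta> \<in> {0..<1}" shows "position t \<theta> \<in> measure_support (cantor_measure t)"
  unfolding measure_support_def
proof (intro CollectI allI impI)
  fix d :: real assume d: "d > 0"
  have "(\<lambda>n. 4 * r / (1 - r) * r ^ n) \<longlonglongrightarrow> 4 * r / (1 - r) * 0"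
    using r_pos r_half by (intro tendsto_mult tendsto_const LIMSEQ_power_zero) auto
  then have "\<forall>\<^sub>F n in sequentially. 4 * r / (1 - r) * r ^ n < d" using d by (auto dest: order_tendstoD(2))
  then obtain n where n: "4 * r / (1 - r) * r ^ n < d" by (auto simp: eventually_sequentially)
  let ?Z = "cylinder n \<lfloor>4 ^ n * \<theta>\<rfloor>"
  have "position t \<theta>' \<in> ball (position t \<theta>) d" if "\<theta>' \<in> ?Z" for \<theta>'
    using dist_position_same_cylinder[of \<theta> n _ \<theta>' t] that assms n by (simp add: dist_norm cylinder_def)
  then have "?Z \<subseteq> position t -` ball (position t \<theta>) d \<inter> {0..<1}" by (auto simp: cylinder_def)
  moreover have "position t -` ball (position t \<theta>) d \<inter> {0..<1} \<in> sets unit_measure"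
    using measurable_sets[OF measurable_position_slice[of t], of "ball (position t \<theta>) d"]
    by (simp add: space_unit_measure)
  ultimately have "emeasure unit_measure ?Z \<le> emeasure (cantor_measure t) (ball (position t \<theta>) d)"
    by (simp add: emeasure_cantor_measure emeasure_mono)
  then show "0 < emeasure (cantor_measure t) (ball (position t \<theta>) d)"
    using emeasure_cylinder_pos[OF assms] less_le_trans by blast
qed

section \<open>The two bounds for the dimension: covering by cells and mass distribution\<close>

definition cell :: "real \<Rightarrow> nat \<Rightarrow> nat \<Rightarrow> (real^2) set" where
  "cell t n i = closure (position t ` cylinder n (int i))"

lemma cell_bounds: "bounded (cell t n i)" "diameter (cell t n i) \<le> 4 * r / (1 - r) * r ^ n"
proof -
  let ?S = "position t ` cylinder n (int i)"
  have *: "norm (x - y) \<le> 4 * r / (1 - r) * r ^ n" if xy: "x \<in> ?S" "y \<in> ?S" for x y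
  proof -
    obtain a a' where "x = position t a" "y = position t a'" "a \<in> cylinder n (int i)" "a' \<in> cylinder n (int i)"
      using xy by blast
    then show ?thesis by (simp only: dist_position_same_cylinder)
  qed
  have b: "bounded ?S"
    unfolding bounded_two_points using * by (auto simp: dist_norm)
  then show "bounded (cell t n i)" by (simp add: cell_def bounded_closure)
  have "0 \<le> 4 * r / (1 - r) * r ^ n" using r_pos r_half by simp
  then have "diameter ?S \<le> 4 * r / (1 - r) * r ^ n" using * by (intro diameter_le) auto
  then show "diameter (cell t n i) \<le> 4 * r / (1 - r) * r ^ n" using b by (simp add: cell_def diameter_closure)
qed

text \<open>The finite union of cells is closed and carries the whole mass, so its complement is an
  open null set. \<open>cell\<close> takes closures because digit sequences ending in ones do not
  occur among the labels, so the image of a cylinder may miss limit points.\<close>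

lemma support_subset_cells: "measure_support (cantor_measure t) \<subseteq> (\<Union>i<4 ^ n. cell t n i)"
proof
  fix x assume x: "x \<in> measure_support (cantor_measure t)"
  show "x \<in> (\<Union>i<4 ^ n. cell t n i)"
  proof (rule ccontr)
    assume "x \<notin> (\<Union>i<4 ^ n. cell t n i)"
    moreover have "open (- (\<Union>i<4 ^ n. cell t n i))"
      by (intro open_Compl closed_UN) (auto simp: cell_def)
    ultimately obtain d where d: "d > 0" "ball x d \<subseteq> - (\<Union>i<4 ^ n. cell t n i)"
      using open_contains_ball by (metis ComplI)
    have "position t \<theta> \<notin> ball x d" if \<theta>: "\<theta> \<in> {0..<1}" for \<theta>
    proof -
      obtain i where i: "i < 4 ^ n" "\<theta> \<in> cylinder n (int i)" using \<theta> cylinder_cover[of n] by blast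
      then have "position t \<theta> \<in> (\<Union>i<4 ^ n. cell t n i)"
        unfolding cell_def using i by (intro UN_I[of i] subsetD[OF closure_subset] imageI) auto
      then show ?thesis using d by blast
    qed
    then have "position t -` ball x d \<inter> {0..<1} = {}" by blast
    then have "emeasure (cantor_measure t) (ball x d) = 0" by (simp add: emeasure_cantor_measure)
    then show False using x d(1) by (auto simp: measure_support_def)
  qed
qed

text \<open>The \<open>4 ^ n\<close> cells of level \<open>n\<close> have diameter at most
  \<open>b * r ^ n\<close>, so their contributions add up to at most
  \<open>b powr s * (4 * r powr s) ^ n\<close>, which tends to 0.\<close>

lemma hausdorff_measure_zero:
  assumes "s > 0" "4 * r powr s < 1"
  shows "hausdorff_measure s (measure_support (cantor_measure t)) = 0"
proof -
  let ?A = "measure_support (cantor_measure t)"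
  define b where "b = 4 * r / (1 - r)"
  have b: "b > 0" using r_pos r_half by (simp add: b_def)
  define v where "v = (\<lambda>n. b powr s * (4 * r powr s) ^ n)"
  have v0: "v \<longlonglongrightarrow> b powr s * 0" unfolding v_def
    using assms by (intro tendsto_mult tendsto_const LIMSEQ_power_zero) auto
  have pre: "hausdorff_pre s \<delta> ?A \<le> ennreal (v n)" if n: "b * r ^ n \<le> \<delta>" and "\<delta> > 0" for \<delta> n
  proof -
    \<comment> \<open>Padding the finite cover with empty sets adds nothing, since
      \<open>diameter {} = 0\<close> and \<open>0 powr s = 0\<close>.\<close>
    define C where "C = (\<lambda>i. if i < 4 ^ n then cell t n i else {})"
    have C: "bounded (C i)" "diameter (C i) \<le> b * r ^ n" for i
    proof -
      have "0 \<le> b * r ^ n" using b r_pos by simp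
      then show "bounded (C i)" "diameter (C i) \<le> b * r ^ n"
        using cell_bounds[of t n i, folded b_def] by (auto simp: C_def)
    qed
    have "?A \<subseteq> (\<Union>i. C i)" using support_subset_cells[of t n] by (auto simp: C_def split: if_splits)
    then have "hausdorff_pre s \<delta> ?A \<le> (\<Sum>i. ennreal (diameter (C i) powr s))"
      unfolding hausdorff_pre_def using C n by (intro INF_lower CollectI conjI allI) (auto intro: order_trans)
    also have "\<dots> = (\<Sum>i<4 ^ n. ennreal (diameter (C i) powr s))"
      by (rule suminf_finite) (auto simp: C_def)
    also have "\<dots> \<le> (\<Sum>i<4 ^ n::nat. ennreal ((b * r ^ n) powr s))"
      using C assms(1) by (intro sum_mono ennreal_leI powr_mono2) (auto simp: diameter_ge_0)
    also have "\<dots> = ennreal (\<Sum>i<4 ^ n::nat. (b * r ^ n) powr s)" by (rule sum_ennreal) simp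
    also have "(\<Sum>i<4 ^ n::nat. (b * r ^ n) powr s) = 4 ^ n * (b * r ^ n) powr s" by simp
    also have "(b * r ^ n) powr s = b powr s * (r powr s) ^ n"
      using b r_pos by (simp add: powr_mult power_powr_commute)
    also have "4 ^ n * (b powr s * (r powr s) ^ n) = v n" by (simp add: v_def power_mult_distrib)
    finally show ?thesis .
  qed
  have "hausdorff_pre s \<delta> ?A = 0" if \<delta>: "\<delta> > 0" for \<delta>
  proof -
    have "(\<lambda>n. b * r ^ n) \<longlonglongrightarrow> b * 0"
      using r_pos r_half by (intro tendsto_mult tendsto_const LIMSEQ_power_zero) auto
    then have "\<forall>\<^sub>F n in sequentially. b * r ^ n < \<delta>" using \<delta> by (auto dest: order_tendstoD(2))
    then have "\<forall>\<^sub>F n in sequentially. hausdorff_pre s \<delta> ?A \<le> ennreal (v n)"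
      by eventually_elim (use pre \<delta> in auto)
    moreover have "(\<lambda>n. ennreal (v n)) \<longlonglongrightarrow> ennreal 0" using v0 by (intro tendsto_ennrealI) simp
    ultimately have "hausdorff_pre s \<delta> ?A \<le> ennreal 0"
      by (intro tendsto_lowerbound[where F = sequentially]) auto
    then show ?thesis by simp
  qed
  then show ?thesis unfolding hausdorff_measure_def by (intro antisym SUP_least) auto
qed

text \<open>The diameter is smaller than every separation \<open>2 * gap k t\<close> with
  \<open>k < n\<close>, so no first disagreement can occur among the leading \<open>2 * n\<close>
  digits, and the preimage lies in one cylinder. Taking the closure makes the preimage of an
  arbitrary covering set measurable without changing the diameter.\<close>

lemma preimage_small_set:
  assumes c: "\<And>j. c * r ^ j \<le> gap j t" "c > 0"
    and C: "bounded C" "diameter C < 2 * c * r ^ n"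
  shows "emeasure unit_measure (position t -` closure C \<inter> {0..<1}) \<le> ennreal (1 / 4 ^ n)"
proof (cases "position t -` closure C \<inter> {0..<1} = {}")
  case False
  then obtain \<theta> where \<theta>: "\<theta> \<in> {0..<1}" "position t \<theta> \<in> closure C" by blast
  have "\<theta>' \<in> cylinder n \<lfloor>4 ^ n * \<theta>\<rfloor>" if \<theta>': "\<theta>' \<in> {0..<1}" "position t \<theta>' \<in> closure C" for \<theta>'
  proof -
    have "dist (position t \<theta>) (position t \<theta>') \<le> diameter (closure C)"
      using \<theta> \<theta>' C by (intro diameter_bounded_bound bounded_closure) auto
    then have d: "norm (position t \<theta> - position t \<theta>') < 2 * c * r ^ n"
      using C by (simp add: diameter_closure dist_norm)
    have agree: "digit (2 * k + i) \<theta> = digit (2 * k + i) \<theta>'"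
      if k: "k < n" and close: "\<bar>coord (\<lambda>k. digit (2 * k + i) \<theta>) t - coord (\<lambda>k. digit (2 * k + i) \<theta>') t\<bar> < 2 * c * r ^ n"
      for k i
      using k
    proof (induction k rule: less_induct)
      case (less k)
      show ?case
      proof (rule ccontr)
        assume "digit (2 * k + i) \<theta> \<noteq> digit (2 * k + i) \<theta>'"
        then have "2 * gap k t \<le> \<bar>coord (\<lambda>k. digit (2 * k + i) \<theta>) t - coord (\<lambda>k. digit (2 * k + i) \<theta>') t\<bar>"
          using less by (intro gap_le_abs_coord_diff signs_digit) auto
        then have "2 * (c * r ^ k) < 2 * c * r ^ n" using c(1)[of k] close by linarith
        moreover have "c * r ^ n \<le> c * r ^ k"
          using less.prems c(2) r_pos r_half by (intro mult_left_mono power_decreasing) auto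
        ultimately show False by simp
      qed
    qed
    have close: "\<bar>coord (\<lambda>k. digit (2 * k + 1) \<theta>) t - coord (\<lambda>k. digit (2 * k + 1) \<theta>') t\<bar> < 2 * c * r ^ n"
      "\<bar>coord (\<lambda>k. digit (2 * k + 2) \<theta>) t - coord (\<lambda>k. digit (2 * k + 2) \<theta>') t\<bar> < 2 * c * r ^ n"
      using component_le_norm_cart[of "position t \<theta> - position t \<theta>'" 1]
        component_le_norm_cart[of "position t \<theta> - position t \<theta>'" 2] d
      by (auto simp: position_def)
    have "digit j \<theta> = digit j \<theta>'" if j: "1 \<le> j" "j \<le> 2 * n" for j
    proof (cases "even j")
      case True
      then obtain k where "j = 2 * k" by blast
      then have "j = 2 * (k - 1) + 2" "k - 1 < n" using j by auto
      then show ?thesis using agree[OF _ close(2)] by metis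
    next
      case False
      then obtain k where "j = 2 * k + 1" by (rule oddE)
      then show ?thesis using agree[OF _ close(1)] j by simp
    qed
    then have "\<lfloor>2 ^ (2 * n) * \<theta>\<rfloor> = \<lfloor>2 ^ (2 * n) * \<theta>'\<rfloor>" by (intro floor_eq_if_digits_eq \<theta> \<theta>') auto
    then show ?thesis using \<theta>' by (simp add: cylinder_def power_mult)
  qed
  then have "emeasure unit_measure (position t -` closure C \<inter> {0..<1}) \<le> emeasure unit_measure (cylinder n \<lfloor>4 ^ n * \<theta>\<rfloor>)"
    by (intro emeasure_mono) (auto simp: sets_restrict_space cylinder_eq)
  then show ?thesis using emeasure_cylinder_le order_trans by blast
qed simp

text \<open>A Frostman-type estimate. If \<open>n\<close> is least with \<open>r ^ n <= d\<close>,
  then \<open>d < r ^ (n - 1)\<close>, so the mass is at most \<open>1 / 4 ^ (n - 1)\<close>, which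
  is \<open>4 * (r powr h) ^ n\<close> because \<open>r powr h = 1/4\<close>; the factor 4 pays for
  the lost level. A set of diameter 0 fits into a cylinder of every level and has no mass; for
  \<open>d >= 1\<close> the total mass 1 is enough.\<close>

lemma mass_distribution:
  assumes h: "h > 0" "4 * r powr h = 1"
    and c: "\<And>j. c * r ^ j \<le> gap j t" "c > 0" and C: "bounded C"
  shows "emeasure unit_measure (position t -` closure C \<inter> {0..<1}) \<le>
    ennreal (4 * (1 / (2 * c)) powr h * diameter C powr h)"
proof -
  let ?M = "emeasure unit_measure (position t -` closure C \<inter> {0..<1})"
  \<comment> \<open>Normalised so that \<open>preimage_small_set\<close> applies at level
    \<open>n\<close> as soon as \<open>d < r ^ n\<close>.\<close>
  define d where "d = diameter C / (2 * c)"
  have d0: "d \<ge> 0" using C c(2) by (simp add: d_def diameter_ge_0)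
  have rhs: "4 * (1 / (2 * c)) powr h * diameter C powr h = 4 * d powr h"
    using c(2) C by (simp add: d_def powr_divide diameter_ge_0)
  have small: "?M \<le> ennreal (1 / 4 ^ n)" if "d < r ^ n" for n
    using that c(2) by (intro preimage_small_set[OF c C]) (simp add: d_def field_simps)
  consider "d = 0" | "d \<ge> 1" | "0 < d" "d < 1" using d0 by linarith
  then have "?M \<le> ennreal (4 * d powr h)"
  proof cases
    case 1
    have "(\<lambda>n. ennreal (1 / 4 ^ n)) \<longlonglongrightarrow> ennreal 0"
      by (intro tendsto_ennrealI) (simp add: LIMSEQ_divide_realpow_zero)
    moreover have "?M \<le> ennreal (1 / 4 ^ n)" for n using small[of n] 1 r_pos by simp
    ultimately have "?M \<le> ennreal 0" by (intro tendsto_lowerbound[where F = sequentially]) auto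
    then show ?thesis using 1 by simp
  next
    case 2
    have "?M \<le> emeasure unit_measure (space unit_measure)" by (rule emeasure_space)
    also have "\<dots> = ennreal 1" by (simp only: emeasure_space_unit_measure ennreal_1)
    also have "\<dots> \<le> ennreal (4 * d powr h)"
      using ge_one_powr_ge_zero[of d h] 2 h by (intro ennreal_leI) linarith
    finally show ?thesis .
  next
    case 3
    have "\<exists>n. r ^ n \<le> d" using real_arch_pow_inv[OF 3(1), of r] r_half by (auto intro: less_imp_le)
    define n where "n = (LEAST n. r ^ n \<le> d)"
    have n: "r ^ n \<le> d" unfolding n_def using \<open>\<exists>n. r ^ n \<le> d\<close> by (rule LeastI_ex)
    then obtain k where k: "n = Suc k" using 3 by (cases n) auto
    have "d < r ^ k" using not_less_Least[of k "\<lambda>n. r ^ n \<le> d"] k by (simp add: n_def)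
    then have "?M \<le> ennreal (1 / 4 ^ k)" by (rule small)
    also have "1 / 4 ^ k = 4 * (r powr h) ^ n"
    proof -
      have "r powr h = 1 / 4" using h by simp
      then have "(r powr h) ^ n = (1 / 4) ^ n" by (rule arg_cong)
      then show ?thesis by (simp add: k power_divide)
    qed
    also have "(r powr h) ^ n = (r ^ n) powr h"
      using r_pos by (simp add: power_powr_commute)
    also have "ennreal (4 * (r ^ n) powr h) \<le> ennreal (4 * d powr h)"
      using n h r_pos by (intro ennreal_leI mult_left_mono powr_mono2) auto
    finally show ?thesis .
  qed
  then show ?thesis by (simp only: rhs)
qed

text \<open>The mass distribution principle: the preimages of a cover exhaust the total mass 1, so
  its sum of diameters to the power \<open>s\<close> is at least \<open>1 / B\<close>. Covers at
  scale 1 suffice, as the measure is a supremum over scales, and diameters at most 1 allow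
  \<open>h\<close> to be replaced by \<open>s\<close>. Admitting \<open>s = h\<close> makes the set
  in \<open>hausdorff_dim\<close> the open ray above \<open>h\<close>.\<close>

lemma hausdorff_measure_pos:
  assumes h: "h > 0" "4 * r powr h = 1" and s: "0 < s" "s \<le> h" and t: "t > 0"
  shows "hausdorff_measure s (measure_support (cantor_measure t)) > 0"
proof -
  let ?A = "measure_support (cantor_measure t)"
  obtain c where c: "c > 0" "\<And>j. c * r ^ j \<le> gap j t" using gap_lower_bound[OF t] by blast
  define B where "B = 4 * (1 / (2 * c)) powr h"
  have B: "B > 0" using c by (simp add: B_def)
  have "ennreal (1 / B) \<le> (\<Sum>i. ennreal (diameter (C i) powr s))"
    if A: "?A \<subseteq> (\<Union>i. C i)" and C: "\<And>i. bounded (C i) \<and> diameter (C i) \<le> 1" for C :: "nat \<Rightarrow> (real^2) set"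
  proof -
    let ?P = "\<lambda>i. position t -` closure (C i) \<inter> {0..<1}"
    have "space unit_measure \<subseteq> (\<Union>i. ?P i)"
    proof
      fix \<theta> assume "\<theta> \<in> space unit_measure"
      then have \<theta>: "\<theta> \<in> {0..<1}" by (simp only: space_unit_measure)
      then have "position t \<theta> \<in> (\<Union>i. C i)" using position_in_support A by blast
      then obtain i where "position t \<theta> \<in> closure (C i)"
        using subsetD[OF closure_subset] by (metis UN_E)
      then show "\<theta> \<in> (\<Union>i. ?P i)" using \<theta> by blast
    qed
    moreover have P: "?P i \<in> sets unit_measure" for i
      using measurable_sets[OF measurable_position_slice[of t], of "closure (C i)"] by (simp add: space_unit_measure)
    moreover have "(\<Union>i. ?P i) \<in> sets unit_measure" using P by (intro sets.countable_UN) blast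
    ultimately have "emeasure unit_measure (space unit_measure) \<le> emeasure unit_measure (\<Union>i. ?P i)"
      by (intro emeasure_mono)
    also have "\<dots> \<le> (\<Sum>i. emeasure unit_measure (?P i))"
      using P by (intro emeasure_subadditive_countably) auto
    also have "\<dots> \<le> (\<Sum>i. ennreal B * ennreal (diameter (C i) powr s))"
    proof (rule suminf_le)
      fix i
      have "emeasure unit_measure (?P i) \<le> ennreal (B * diameter (C i) powr h)"
        unfolding B_def using C by (intro mass_distribution h c) auto
      also have "\<dots> \<le> ennreal (B * diameter (C i) powr s)"
        using C[of i] B s by (intro ennreal_leI mult_left_mono powr_mono') (auto simp: diameter_ge_0)
      finally show "emeasure unit_measure (?P i) \<le> ennreal B * ennreal (diameter (C i) powr s)"
        using B by (simp add: ennreal_mult)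
    qed auto
    also have "\<dots> = ennreal B * (\<Sum>i. ennreal (diameter (C i) powr s))" by (rule ennreal_suminf_cmult)
    finally have 1: "1 \<le> ennreal B * (\<Sum>i. ennreal (diameter (C i) powr s))"
      by (simp only: emeasure_space_unit_measure)
    have "ennreal (1 / B) * 1 \<le> ennreal (1 / B) * (ennreal B * (\<Sum>i. ennreal (diameter (C i) powr s)))"
      using 1 by (rule mult_left_mono) simp
    also have "\<dots> = (ennreal (1 / B) * ennreal B) * (\<Sum>i. ennreal (diameter (C i) powr s))"
      by (simp only: mult.assoc)
    also have "ennreal (1 / B) * ennreal B = 1" using B by (simp flip: ennreal_mult)
    finally show ?thesis by simp
  qed
  then have le: "ennreal (1 / B) \<le> hausdorff_pre s 1 ?A"
    unfolding hausdorff_pre_def by (intro INF_greatest) auto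
  have "0 < ennreal (1 / B)" using B by simp
  also note le
  also have "hausdorff_pre s 1 ?A \<le> hausdorff_measure s ?A"
    unfolding hausdorff_measure_def by (intro SUP_upper) auto
  finally show ?thesis .
qed

lemma hausdorff_dim_support:
  assumes h: "h > 0" "4 * r powr h = 1" and t: "t > 0"
  shows "hausdorff_dim (measure_support (cantor_measure t)) = h"
proof -
  have "s > 0 \<and> hausdorff_measure s (measure_support (cantor_measure t)) = 0 \<longleftrightarrow> h < s" for s
  proof (cases "h < s")
    case True
    have "r powr s < r powr h" using True r_pos r_half by (intro powr_less_mono') auto
    then show ?thesis using True h hausdorff_measure_zero[of s t] by auto
  next
    case False
    then show ?thesis using hausdorff_measure_pos[OF h _ _ t, of s] by auto
  qed
  then have "{s. s > 0 \<and> hausdorff_measure s (measure_support (cantor_measure t)) = 0} = {h<..}" by auto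
  then show ?thesis unfolding hausdorff_dim_def by simp
qed

end

theorem theorem1:
  fixes h :: real
  assumes "1 < h" and "h < 2"
  shows "\<exists>(u :: real \<Rightarrow> real^2 \<Rightarrow> real^2) (\<omega> :: real \<Rightarrow> (real^2) measure).
     continuous_on ({0..} \<times> UNIV) (\<lambda>(t, x). u t x) \<and>
     uniformly_continuous_on ({0..} \<times> UNIV) (\<lambda>(t, x). u t x) \<and>
     (\<exists>K. compact K \<and> K \<subseteq> {0..} \<times> UNIV \<and>
        (\<forall>t\<ge>0. \<forall>x. (t, x) \<notin> K \<longrightarrow> u t x = 0)) \<and>
     weakly_div_free u \<and>
     (\<forall>t\<ge>0. locally_finite_borel (\<omega> t)) \<and>
     (\<forall>T>0. weakly_advected u \<omega> T) \<and>
     measure_support (\<omega> 0) = {0} \<and>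
     (\<forall>t>0. hausdorff_dim (measure_support (\<omega> t)) = h) \<and>
     locally_lipschitz_on (({0..} \<times> UNIV) - {(0, 0)}) (\<lambda>(t, x). u t x)"
proof -
  \<comment> \<open>Solves \<open>4 * r powr h = 1\<close>, the dimension equation for four copies
    of ratio \<open>r\<close>; the bound \<open>h < 2\<close> becomes \<open>r < 1/2\<close>, the
    room needed between the squares.\<close>
  define r where "r = 4 powr (- 1 / h)"
  have "r < 4 powr (- (1 / 2))" unfolding r_def using assms by (intro powr_less_mono) (auto simp: field_simps)
  also have "4 powr (- (1 / 2)) = (1 / 2 :: real)" by (simp add: powr_minus powr_half_sqrt inverse_eq_divide)
  finally have r: "0 < r" "r < 1 / 2" by (auto simp: r_def)
  have "r powr h = 4 powr (- 1)" unfolding r_def powr_powr using assms by simp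
  then have rh: "4 * r powr h = 1" by (simp add: powr_minus)
  interpret cantor_flow r by unfold_locales (rule r)+
  show ?thesis
  proof (intro exI[of _ velocity] exI[of _ cantor_measure] conjI allI impI)
    show "continuous_on ({0..} \<times> UNIV) (\<lambda>(t, x). velocity t x)"
      by (rule continuous_on_subset[OF continuous_on_velocity]) simp
    show "uniformly_continuous_on ({0..} \<times> UNIV) (\<lambda>(t, x). velocity t x)"
      using uniformly_continuous_on_velocity unfolding uniformly_continuous_on_def by blast
    show "\<exists>K. compact K \<and> K \<subseteq> {0..} \<times> UNIV \<and> (\<forall>t\<ge>0. \<forall>x. (t, x) \<notin> K \<longrightarrow> velocity t x = 0)"
      using compact_velocity_box velocity_outside_box
      by (intro exI[of _ velocity_box]) (auto simp: velocity_box_def)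
    show "hausdorff_dim (measure_support (cantor_measure t)) = h" if "t > 0" for t
      using assms that by (intro hausdorff_dim_support rh) auto
  qed (simp_all add: weakly_div_free_velocity locally_finite_cantor_measure weakly_advected_cantor_measure
      support_cantor_measure_0 locally_lipschitz_on_velocity)
qed

end
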